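(* Let $a\ge2$ and $r\ge2$ be integers with $r\le 2^a-1$. Let $F$ be the complete $r$-partite graph whose parts all have size $a$. For every real $\alpha\ge1$ and every integer $n\ge1$, $$\operatorname{spec}_\alpha^{\mathrm{ind}}(F,n)=\max_{\substack{n_1,\ldots,n_r\ge0\\ n_1+\cdots+n_r=n}}\lambda_\alpha^{\mathrm{ind}}(F,K_{n_1,n_2,\ldots,n_r}),$$ where the maximum is over integers $n_1,\ldots,n_r$ and parts of size zero are omitted.
   Context: Graphs are finite and simple. $K_{n_1,\ldots,n_q}$ denotes the complete multipartite graph with independent parts of sizes $n_1,\ldots,n_q$ in which any two vertices in different parts are adjacent; parts of size zero are omitted. Let $F$ be an $\ell$-vertex graph and $G$ an $n$-vertex graph; vectors in $\mathbb{R}^n$ are indexed by $V(G)$. Put $H_F(G)=\{S\subseteq V(G): G[S]\cong F\}$, where $G[S]$ is the induced subgraph, and $P_{F,G}(\mathbf{x})=\ell!\sum_{e\in H_F(G)}\prod_{i\in e}x_i$. For real $\alpha\ge1$ define $\lambda_\alpha^{\mathrm{ind}}(F,G)=\max\{P_{F,G}(\mathbf{x}):\mathbf{x}\in\mathbb{R}^n,\ \sum_i|x_i|^\alpha=1\}$ and $\operatorname{spec}_\alpha^{\mathrm{ind}}(F,n)=\max\{\lambda_\alpha^{\mathrm{ind}}(F,G): G\text{ an }n\text{-vertex graph}\}$. *)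

theory Defs
  imports "HOL-Analysis.Analysis" "Graph_Theory.Digraph_Isomorphism" "Graph_Theory.Pair_Digraph"
begin

text \<open>
  Finite simple graphs are the \<^locale>\<open>pair_graph\<close>s of the library: an undirected edge is the
  pair of its two opposite arcs.
\<close>

text \<open>
  Vertex \<open>(i, j)\<close> is the \<open>j\<close>-th vertex of the \<open>i\<close>-th part, so that entries \<open>0\<close> of
  the list contribute no vertices.
\<close>

definition complete_multipartite :: "nat list \<Rightarrow> (nat \<times> nat) pair_pre_digraph" where
  "complete_multipartite ns =
    (let V = {(i, j). i < length ns \<and> j < ns ! i}
     in \<lparr> pverts = V, parcs = {(u, v). u \<in> V \<and> v \<in> V \<and> fst u \<noteq> fst v} \<rparr>)"

definition ind_copies :: "'b pair_pre_digraph \<Rightarrow> 'a pair_pre_digraph \<Rightarrow> 'a set set" where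
  "ind_copies F G =
    {S. S \<subseteq> pverts G \<and> digraph_iso (induce_subgraph (with_proj G) S) (with_proj F)}"

definition ind_poly :: "'b pair_pre_digraph \<Rightarrow> 'a pair_pre_digraph \<Rightarrow> ('a \<Rightarrow> real) \<Rightarrow> real" where
  "ind_poly F G x = fact (card (pverts F)) * (\<Sum>e\<in>ind_copies F G. \<Prod>i\<in>e. x i)"

text \<open>
  A vector indexed by a vertex set \<open>V\<close> is a function on the whole vertex type; its values outside
  \<open>V\<close> affect neither \<open>ind_poly\<close> nor the constraint below.
\<close>

definition unit_vectors :: "real \<Rightarrow> 'a set \<Rightarrow> ('a \<Rightarrow> real) set" where
  "unit_vectors \<alpha> V = {x. (\<Sum>i\<in>V. \<bar>x i\<bar> powr \<alpha>) = 1}"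

text \<open>
  The supremum is a maximum for \<open>\<alpha> > 0\<close> and every graph with at least one vertex, see
  \<open>lambda_ind_attained\<close> below.
\<close>

definition lambda_ind :: "real \<Rightarrow> 'b pair_pre_digraph \<Rightarrow> 'a pair_pre_digraph \<Rightarrow> real" where
  "lambda_ind \<alpha> F G = (SUP x\<in>unit_vectors \<alpha> (pverts G). ind_poly F G x)"

text \<open>
  The \<open>n\<close>-vertex graphs are represented by those on the vertex set \<open>{..<n}\<close>, of which there are
  finitely many. By \<open>lambda_ind_le_spec_ind\<close> below, \<open>spec_ind\<close> is the maximum over all
  \<open>n\<close>-vertex graphs on any vertex type.
\<close>

definition graphs_on :: "nat \<Rightarrow> nat pair_pre_digraph set" where
  "graphs_on n = {G. pair_graph G \<and> pverts G = {..<n}}"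

definition spec_ind :: "real \<Rightarrow> 'b pair_pre_digraph \<Rightarrow> nat \<Rightarrow> real" where
  "spec_ind \<alpha> F n = Max (lambda_ind \<alpha> F ` graphs_on n)"

definition compositions :: "nat \<Rightarrow> nat \<Rightarrow> nat list set" where
  "compositions r n = {ns. length ns = r \<and> sum_list ns = n}"


text \<open>The objects above are well-defined and the maxima exist.\<close>

lemma finite_compositions: "finite (compositions r n)"
proof (rule finite_subset)
  show "compositions r n \<subseteq> {ns. set ns \<subseteq> {..n} \<and> length ns = r}"
    by (auto simp: compositions_def dest: member_le_sum_list)
  show "finite {ns. set ns \<subseteq> {..n} \<and> length ns = r}"
    by (rule finite_lists_length_eq) simp
qed

lemma compositions_nonempty: "r \<ge> 1 \<Longrightarrow> compositions r n \<noteq> {}"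
  by (auto simp: compositions_def sum_list_replicate intro!: exI[of _ "n # replicate (r - 1) 0"])

lemma finite_graphs_on: "finite (graphs_on n)"
proof (rule finite_subset)
  show "graphs_on n \<subseteq> (\<lambda>A. \<lparr> pverts = {..<n}, parcs = A \<rparr>) ` Pow ({..<n} \<times> {..<n})"
  proof
    fix G :: "nat pair_pre_digraph"
    assume "G \<in> graphs_on n"
    then have G: "pair_graph G" "pverts G = {..<n}"
      by (auto simp: graphs_on_def)
    interpret pair_graph G by (rule G(1))
    have "parcs G \<subseteq> {..<n} \<times> {..<n}"
      using in_arcsD1 in_arcsD2 G(2) by fastforce
    moreover have "G = \<lparr> pverts = {..<n}, parcs = parcs G \<rparr>"
      using G(2) by simp
    ultimately show "G \<in> (\<lambda>A. \<lparr> pverts = {..<n}, parcs = A \<rparr>) ` Pow ({..<n} \<times> {..<n})"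
      by blast
  qed
qed auto

lemma pair_graphI:
  assumes "finite (pverts G)" "parcs G \<subseteq> pverts G \<times> pverts G"
    and "\<And>u v. (u, v) \<in> parcs G \<Longrightarrow> (v, u) \<in> parcs G"
    and "\<And>u. (u, u) \<notin> parcs G"
  shows "pair_graph G"
proof unfold_locales
  show "finite (parcs G)"
    using assms(1,2) by (meson finite_SigmaI finite_subset)
  show "symmetric (with_proj G)"
    using assms(3) by (auto simp: symmetric_def intro: symI)
qed (use assms in auto)

lemma graphs_on_nonempty: "graphs_on n \<noteq> {}"
proof -
  have "\<lparr> pverts = {..<n}, parcs = {} \<rparr> \<in> graphs_on n"
    by (auto simp: graphs_on_def intro!: pair_graphI)
  then show ?thesis by blast
qed

lemma pverts_complete_multipartite:
  "pverts (complete_multipartite ns) = (SIGMA i:{..<length ns}. {..<ns ! i})"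
  by (auto simp: complete_multipartite_def Let_def)

lemma card_complete_multipartite: "card (pverts (complete_multipartite ns)) = sum_list ns"
  by (simp add: pverts_complete_multipartite sum_list_sum_nth atLeast0LessThan)

lemma pair_graph_complete_multipartite: "pair_graph (complete_multipartite ns)"
proof (rule pair_graphI)
  show "finite (pverts (complete_multipartite ns))"
    by (simp add: pverts_complete_multipartite)
qed (auto simp: complete_multipartite_def Let_def)

lemma lambda_ind_attained:
  fixes F :: "'b pair_pre_digraph" and G :: "'a pair_pre_digraph"
  assumes fin: "finite (pverts G)" and ne: "pverts G \<noteq> {}" and \<alpha>: "\<alpha> > 0"
  shows "\<exists>x\<in>unit_vectors \<alpha> (pverts G). ind_poly F G x = lambda_ind \<alpha> F G"
    and "x \<in> unit_vectors \<alpha> (pverts G) \<Longrightarrow> ind_poly F G x \<le> lambda_ind \<alpha> F G"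
proof -
  define V where "V = pverts G"
  define B where "B = (\<lambda>i. if i \<in> V then {-1..1::real} else {0})"
  define K where "K = PiE UNIV B \<inter> unit_vectors \<alpha> V"
  have finV: "finite V" and neV: "V \<noteq> {}"
    using fin ne by (auto simp: V_def)
  have "compactin (product_topology (\<lambda>i. euclidean) UNIV) (PiE UNIV B)"
    by (subst compactin_PiE) (auto simp: B_def)
  then have "compact (PiE UNIV B)"
    by (simp add: euclidean_product_topology)
  moreover have "closed (unit_vectors \<alpha> V)"
  proof -
    have "continuous_on UNIV (\<lambda>x::'a \<Rightarrow> real. \<Sum>i\<in>V. \<bar>x i\<bar> powr \<alpha>)"
      using \<alpha> by (auto intro!: continuous_intros continuous_on_powr' continuous_on_product_coordinates)
    then show ?thesis
      unfolding unit_vectors_def by (intro closed_Collect_eq) auto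
  qed
  ultimately have compK: "compact K"
    unfolding K_def by blast
  have neK: "K \<noteq> {}"
  proof -
    obtain v where v: "v \<in> V" using neV by blast
    have "(\<Sum>i\<in>V. \<bar>if i = v then 1 else 0\<bar> powr \<alpha>) = (\<Sum>i\<in>V. if i = v then 1 else 0)"
      by (intro sum.cong) auto
    also have "\<dots> = (1::real)"
      using v finV by simp
    finally have "(\<lambda>i. if i = v then 1 else 0) \<in> K"
      using v by (auto simp: K_def B_def unit_vectors_def PiE_def)
    then show ?thesis by blast
  qed
  have finC: "finite (ind_copies F G)"
    using fin by (auto simp: ind_copies_def)
  have cont: "continuous_on K (ind_poly F G)"
    unfolding ind_poly_def
    by (intro continuous_intros continuous_on_subset[OF continuous_on_product_coordinates]) auto
  obtain m where m: "m \<in> K" "\<And>x. x \<in> K \<Longrightarrow> ind_poly F G x \<le> ind_poly F G m"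
    using continuous_attains_sup[OF compK neK cont] by blast
  have bound: "ind_poly F G x \<le> ind_poly F G m" if x: "x \<in> unit_vectors \<alpha> V" for x
  proof -
    define y where "y = (\<lambda>i. if i \<in> V then x i else 0)"
    have "ind_poly F G x = ind_poly F G y"
      unfolding ind_poly_def y_def
      by (intro arg_cong2[where f = "(*)"] refl sum.cong prod.cong)
        (auto simp: ind_copies_def V_def)
    moreover have "y \<in> K"
    proof -
      have "\<bar>x i\<bar> \<le> 1" if i: "i \<in> V" for i
      proof (rule ccontr)
        assume "\<not> \<bar>x i\<bar> \<le> 1"
        then have "1 < \<bar>x i\<bar> powr \<alpha>"
          using \<alpha> by (intro gr_one_powr) auto
        also have "\<dots> \<le> (\<Sum>i\<in>V. \<bar>x i\<bar> powr \<alpha>)"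
          using finV i by (intro member_le_sum) auto
        finally show False using x by (simp add: unit_vectors_def)
      qed
      then have "y \<in> PiE UNIV B"
        by (auto simp: y_def B_def PiE_def Pi_def abs_le_iff minus_le_iff)
      moreover have "y \<in> unit_vectors \<alpha> V"
        using x by (simp add: unit_vectors_def y_def)
      ultimately show ?thesis by (simp add: K_def)
    qed
    ultimately show ?thesis using m(2) by simp
  qed
  have "lambda_ind \<alpha> F G = ind_poly F G m"
    unfolding lambda_ind_def V_def[symmetric]
    using bound m(1) by (intro cSup_eq_maximum) (auto simp: K_def)
  then show "\<exists>x\<in>unit_vectors \<alpha> (pverts G). ind_poly F G x = lambda_ind \<alpha> F G"
    and "x \<in> unit_vectors \<alpha> (pverts G) \<Longrightarrow> ind_poly F G x \<le> lambda_ind \<alpha> F G"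
    using m(1) bound by (auto simp: K_def V_def)
qed

lemma image_arcs_restrict:
  assumes inj: "inj_on f V" and S: "S \<subseteq> V" and A: "A \<subseteq> V \<times> V"
  shows "{e \<in> map_prod f f ` A. fst e \<in> f ` S \<and> snd e \<in> f ` S}
    = map_prod f f ` {e \<in> A. fst e \<in> S \<and> snd e \<in> S}"
proof -
  have mem: "f a \<in> f ` S \<longleftrightarrow> a \<in> S" if "a \<in> V" for a
    using inj_on_image_mem_iff[OF inj that S] .
  have "{e \<in> map_prod f f ` A. P e} = map_prod f f ` {e \<in> A. P (map_prod f f e)}" for P
    by (rule Compr_image_eq)
  also have "{e \<in> A. fst (map_prod f f e) \<in> f ` S \<and> snd (map_prod f f e) \<in> f ` S}
      = {e \<in> A. fst e \<in> S \<and> snd e \<in> S}"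
  proof (rule Collect_cong, rule conj_cong[OF refl])
    fix e assume "e \<in> A"
    then have "fst e \<in> V" "snd e \<in> V"
      using A by auto
    then show "(fst (map_prod f f e) \<in> f ` S \<and> snd (map_prod f f e) \<in> f ` S)
        = (fst e \<in> S \<and> snd e \<in> S)"
      using mem by (simp only: fst_map_prod snd_map_prod)
  qed
  finally show ?thesis .
qed

lemma lambda_ind_le_spec_ind:
  fixes F :: "'b pair_pre_digraph" and G :: "'a pair_pre_digraph"
  assumes G: "pair_graph G" and card: "card (pverts G) = n" and n: "n \<ge> 1" and \<alpha>: "\<alpha> > 0"
  shows "lambda_ind \<alpha> F G \<le> spec_ind \<alpha> F n"
proof -
  interpret pair_graph G by (rule G)
  define V where "V = pverts G"
  have finV: "finite V" and neV: "V \<noteq> {}"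
    using card n pair_finite_verts by (auto simp: V_def)
  have AV: "(u, v) \<in> parcs G \<Longrightarrow> u \<in> V \<and> v \<in> V" for u v
    using in_arcsD1 in_arcsD2 by (auto simp: V_def)
  have PV: "parcs G \<subseteq> V \<times> V"
    using AV by auto
  obtain f where f: "bij_betw f V {..<n}"
    using ex_bij_betw_finite_nat[OF finV] card by (auto simp: V_def atLeast0LessThan)
  have inj: "inj_on f V" and im: "f ` V = {..<n}"
    using f by (auto simp: bij_betw_def)
  define H where "H = \<lparr> pverts = {..<n}, parcs = map_prod f f ` parcs G \<rparr>"
  have H: "pair_graph H"
  proof (rule pair_graphI)
    show "parcs H \<subseteq> pverts H \<times> pverts H"
      using AV im by (auto simp: H_def dest!: AV)
    show "(v, u) \<in> parcs H" if uv: "(u, v) \<in> parcs H" for u v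
    proof -
      obtain a b where ab: "(a, b) \<in> parcs G" "u = f a" "v = f b"
        using uv by (auto simp: H_def)
      have "sym (parcs G)"
        using pair_sym_arcs by (simp add: symmetric_def)
      then have "(b, a) \<in> parcs G"
        using ab(1) by (rule symD)
      then have "map_prod f f (b, a) \<in> parcs H"
        unfolding H_def pair_pre_digraph.simps by (rule imageI)
      then show ?thesis using ab by simp
    qed
    show "(u, u) \<notin> parcs H" for u
    proof
      assume "(u, u) \<in> parcs H"
      then obtain a b where ab: "(a, b) \<in> parcs G" "u = f a" "u = f b"
        by (auto simp: H_def)
      then have "a = b"
        using AV[OF ab(1)] by (intro inj_onD[OF inj]) auto
      then show False
        using pair_no_loops[OF ab(1)] by simp
    qed
  qed (simp add: H_def)
  have iso: "digraph_iso (induce_subgraph (with_proj G) S) (induce_subgraph (with_proj H) (f ` S))"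
    and wf: "wf_digraph (induce_subgraph (with_proj G) S)" if S: "S \<subseteq> V" for S
  proof -
    show wf: "wf_digraph (induce_subgraph (with_proj G) S)"
      by (auto simp: wf_digraph_def)
    define h where "h = \<lparr> iso_verts = f, iso_arcs = map_prod f f, iso_head = snd, iso_tail = fst \<rparr>"
    have injS: "inj_on f S" using inj S by (rule inj_on_subset)
    have "pre_digraph.digraph_isomorphism (induce_subgraph (with_proj G) S) h"
      unfolding pre_digraph.digraph_isomorphism_def
    proof (intro conjI wf)
      have "inj_on (map_prod f f) (S \<times> S)"
        using injS by (rule map_prod_inj_on) (rule injS)
      then show "inj_on (iso_arcs h) (arcs (induce_subgraph (with_proj G) S))"
        unfolding h_def digraph_isomorphism.simps by (rule inj_on_subset) auto
    qed (simp_all add: h_def injS)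
    moreover have "induce_subgraph (with_proj H) (f ` S) = app_iso h (induce_subgraph (with_proj G) S)"
      using image_arcs_restrict[OF inj S PV]
      by (simp add: induce_subgraph_def app_iso_def h_def H_def)

    ultimately show "digraph_iso (induce_subgraph (with_proj G) S) (induce_subgraph (with_proj H) (f ` S))"
      unfolding digraph_iso_def by blast
  qed
  have copies: "ind_copies F H = (\<lambda>S. f ` S) ` ind_copies F G"
  proof (intro set_eqI iffI)
    fix T assume "T \<in> ind_copies F H"
    then have T: "T \<subseteq> {..<n}" "digraph_iso (induce_subgraph (with_proj H) T) (with_proj F)"
      by (auto simp: ind_copies_def H_def)
    then obtain S where S: "S \<subseteq> V" "T = f ` S"
      using im by (metis subset_imageE)
    with T(2) iso[OF S(1)] have "digraph_iso (induce_subgraph (with_proj G) S) (with_proj F)"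
      by (auto intro: digraph_iso_trans)
    with S show "T \<in> (\<lambda>S. f ` S) ` ind_copies F G"
      by (auto simp: ind_copies_def V_def)
  next
    fix T assume "T \<in> (\<lambda>S. f ` S) ` ind_copies F G"
    then obtain S where S: "S \<subseteq> V" "T = f ` S"
      "digraph_iso (induce_subgraph (with_proj G) S) (with_proj F)"
      by (auto simp: ind_copies_def V_def)
    have "digraph_iso (induce_subgraph (with_proj H) T) (with_proj F)"
      using digraph_iso_trans[OF digraph_iso_swap[OF wf[OF S(1)] iso[OF S(1)]] S(3)] S(2) by simp
    with S im show "T \<in> ind_copies F H"
      by (auto simp: ind_copies_def H_def)
  qed
  have poly: "ind_poly F H x = ind_poly F G (x \<circ> f)" for x
  proof -
    have sub: "S \<subseteq> V" if "S \<in> ind_copies F G" for S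
      using that by (auto simp: ind_copies_def V_def)
    have "inj_on (\<lambda>S. f ` S) (ind_copies F G)"
      using sub inj by (meson inj_onI inj_on_image_eq_iff)
    then have "(\<Sum>e\<in>ind_copies F H. \<Prod>i\<in>e. x i) = (\<Sum>S\<in>ind_copies F G. \<Prod>i\<in>f ` S. x i)"
      by (simp add: copies sum.reindex)
    also have "\<dots> = (\<Sum>S\<in>ind_copies F G. \<Prod>i\<in>S. (x \<circ> f) i)"
      using inj_on_subset[OF inj sub] by (intro sum.cong) (auto simp: prod.reindex)
    finally show ?thesis by (simp add: ind_poly_def)
  qed
  obtain y where y: "y \<in> unit_vectors \<alpha> V" "ind_poly F G y = lambda_ind \<alpha> F G"
    using lambda_ind_attained(1)[of G \<alpha> F] finV neV \<alpha> by (auto simp: V_def)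
  define x where "x = y \<circ> inv_into V f"
  have xf: "x (f i) = y i" if "i \<in> V" for i
    using that inj by (simp add: x_def)
  have "(\<Sum>j\<in>f ` V. \<bar>x j\<bar> powr \<alpha>) = (\<Sum>i\<in>V. \<bar>y i\<bar> powr \<alpha>)"
    using inj xf by (simp add: sum.reindex)
  then have "x \<in> unit_vectors \<alpha> (pverts H)"
    using y(1) im by (simp add: unit_vectors_def H_def)
  then have "ind_poly F H x \<le> lambda_ind \<alpha> F H"
    using n \<alpha> by (intro lambda_ind_attained(2)) (auto simp: H_def lessThan_empty_iff)
  moreover have "ind_poly F H x = ind_poly F G y"
    unfolding poly unfolding ind_poly_def
    by (intro arg_cong2[where f = "(*)"] refl sum.cong prod.cong)
      (auto simp: ind_copies_def V_def[symmetric] xf subset_iff)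
  moreover have "lambda_ind \<alpha> F H \<le> spec_ind \<alpha> F n"
    unfolding spec_ind_def using H
    by (intro Max_ge finite_imageI finite_graphs_on imageI) (simp add: graphs_on_def H_def)
  ultimately show ?thesis using y(2) by simp
qed

end

theory Submission
  imports Defs
begin

text \<open>
  Write \<open>F\<close> for the complete \<open>r\<close>-partite graph with parts of size \<open>a\<close>. Replacing \<open>x\<close> by \<open>\<bar>x\<bar>\<close> keeps
  the constraint and does not decrease the polynomial, so only nonnegative vectors matter. For a
  fixed nonnegative \<open>x\<close>, every graph on \<open>V\<close> can be turned into a complete multipartite graph on \<open>V\<close>
  with at most \<open>r\<close> parts without decreasing the polynomial at \<open>x\<close>. As \<open>x\<close> itself never changes, the
  norm constraint plays its part only in the last step, where the pointwise comparison becomes one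
  of maxima.

  There are two moves. The first is Zykov symmetrization. Two nonadjacent vertices \<open>u\<close> and \<open>v\<close> of a
  copy of \<open>F\<close> lie in the same part, hence have the same neighbours in the copy. Making \<open>u\<close> a clone of
  \<open>v\<close> therefore preserves all copies that contain both, and trades the copies that contain only \<open>u\<close>
  for translates of those that contain only \<open>v\<close>. Up to exchanging \<open>u\<close> and \<open>v\<close>, this does not decrease
  the polynomial (\<open>copy_sum_clone_ge\<close>). A maximizer with the largest number of pairs of twins admits
  no further move, and then non-adjacency is an equivalence relation
  (\<open>exists_multipartite_copy_sum_ge\<close>).

  The second move merges two parts. On a complete multipartite graph with parts \<open>V\<^sub>1, \<dots>, V\<^sub>q\<close> the
  polynomial is, up to a factorial, the elementary symmetric polynomial \<open>e\<^sub>r\<close> in the numbers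
  \<open>y\<^sub>i = e\<^sub>a (x on V\<^sub>i)\<close>. Suppose \<open>q > r\<close>, let \<open>y\<^sub>1 \<le> y\<^sub>2\<close> be the two smallest of these numbers, and let \<open>E\<^sub>k\<close>
  be \<open>e\<^sub>k\<close> of the others. Merging \<open>V\<^sub>1\<close> and \<open>V\<^sub>2\<close> replaces \<open>(y\<^sub>1 + y\<^sub>2) E\<^bsub>r-1\<^esub> + y\<^sub>1 y\<^sub>2 E\<^bsub>r-2\<^esub>\<close> by
  \<open>z E\<^bsub>r-1\<^esub>\<close> with \<open>z = e\<^sub>a (x on V\<^sub>1 \<union> V\<^sub>2)\<close>. Since the other numbers are at least \<open>y\<^sub>2\<close>, double counting
  gives \<open>y\<^sub>2 E\<^bsub>r-2\<^esub> \<le> (r - 1) E\<^bsub>r-1\<^esub>\<close>, and a consequence of Newton's inequalities gives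
  \<open>z \<ge> y\<^sub>2 + (2\<^sup>a - 1) y\<^sub>1\<close> (\<open>esym_Un_ge\<close>). So merging pays off as soon as \<open>r - 1 \<le> 2\<^sup>a - 2\<close>, which is the
  hypothesis on \<open>r\<close> (\<open>exists_merged_coloring\<close>).
\<close>

section \<open>Elementary symmetric polynomials\<close>

definition esym :: "nat \<Rightarrow> 'a set \<Rightarrow> ('a \<Rightarrow> real) \<Rightarrow> real" where
  "esym k A x = (\<Sum>S | S \<subseteq> A \<and> card S = k. \<Prod>i\<in>S. x i)"

lemma sum_subsets_insert:
  fixes g :: "'a set \<Rightarrow> real"
  assumes "finite W" "v \<notin> W"
  shows "(\<Sum>S\<in>Pow (insert v W). g S) = (\<Sum>S\<in>Pow W. g S) + (\<Sum>S\<in>Pow W. g (insert v S))"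
proof -
  have "inj_on (insert v) (Pow W)"
    using assms(2) by (auto simp: inj_on_def)
  moreover have "Pow W \<inter> insert v ` Pow W = {}"
    using assms(2) by auto
  ultimately show ?thesis
    using assms(1) by (simp add: Pow_insert sum.union_disjoint sum.reindex)
qed

lemma esym_Pow:
  assumes "finite A"
  shows "esym k A x = (\<Sum>S\<in>Pow A. if card S = k then \<Prod>i\<in>S. x i else 0)"
  using assms by (simp add: esym_def Pow_def sum.inter_filter[symmetric])

lemma esym_0: "finite A \<Longrightarrow> esym 0 A x = 1"
proof -
  assume "finite A"
  then have "{S. S \<subseteq> A \<and> card S = 0} = {{}}"
    by (auto dest: finite_subset)
  then show ?thesis by (simp add: esym_def)
qed

lemma esym_insert:
  assumes A: "finite A" and v: "v \<notin> A"
  shows "esym (Suc k) (insert v A) x = esym (Suc k) A x + x v * esym k A x"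
proof -
  have "(\<Sum>S\<in>Pow A. if card (insert v S) = Suc k then \<Prod>i\<in>insert v S. x i else 0)
      = (\<Sum>S\<in>Pow A. x v * (if card S = k then \<Prod>i\<in>S. x i else 0))"
  proof (rule sum.cong[OF refl])
    fix S assume "S \<in> Pow A"
    then have "finite S" "v \<notin> S"
      using A v by (auto dest: finite_subset)
    then show "(if card (insert v S) = Suc k then \<Prod>i\<in>insert v S. x i else 0)
        = x v * (if card S = k then \<Prod>i\<in>S. x i else 0)"
      by simp
  qed
  then show ?thesis
    using A v by (simp add: esym_Pow sum_subsets_insert sum_distrib_left)
qed

lemma esym_cong: "(\<And>i. i \<in> A \<Longrightarrow> x i = y i) \<Longrightarrow> esym k A x = esym k A y"
  unfolding esym_def by (intro sum.cong prod.cong) auto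

lemma esym_nonneg: "(\<And>i. i \<in> A \<Longrightarrow> 0 \<le> x i) \<Longrightarrow> 0 \<le> esym k A x"
  unfolding esym_def by (intro sum_nonneg prod_nonneg) auto

lemma esym_eq_0:
  assumes "finite A" "card A < k"
  shows "esym k A x = 0"
proof -
  have "{S. S \<subseteq> A \<and> card S = k} = {}"
    using assms by (auto dest: card_mono[OF assms(1)])
  then show ?thesis
    unfolding esym_def by (simp only: sum.empty)
qed

lemma esym_Un:
  assumes "finite A" "finite B" "A \<inter> B = {}"
  shows "esym k (A \<union> B) x = (\<Sum>j\<le>k. esym j A x * esym (k - j) B x)"
  using assms
proof (induction A arbitrary: k rule: finite_induct)
  case empty
  have "esym j {} x = (if j = 0 then 1 else 0)" for j
    by (cases j) (simp_all add: esym_0 esym_eq_0)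
  then show ?case
    by (simp add: if_distrib[where f = "\<lambda>t. t * _"] cong: if_cong)
next
  case (insert v A)
  have v: "v \<notin> A \<union> B" and AB: "finite (A \<union> B)"
    using insert by auto
  show ?case
  proof (cases k)
    case 0
    then show ?thesis using insert by (simp add: esym_0)
  next
    case (Suc m)
    have "(\<Sum>j\<le>k. esym j (insert v A) x * esym (k - j) B x)
        = esym k B x + (\<Sum>j\<le>m. (esym (Suc j) A x + x v * esym j A x) * esym (m - j) B x)"
      using insert(1,2) Suc
      by (simp add: sum.atMost_Suc_shift esym_insert esym_0 del: sum.atMost_Suc)
    also have "\<dots> = (\<Sum>j\<le>k. esym j A x * esym (k - j) B x)
        + x v * (\<Sum>j\<le>m. esym j A x * esym (m - j) B x)"
      using insert(1) Suc
      by (simp add: sum.atMost_Suc_shift esym_0 distrib_right sum.distrib sum_distrib_left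
        mult.assoc del: sum.atMost_Suc)
    also have "\<dots> = esym k (A \<union> B) x + x v * esym m (A \<union> B) x"
      using insert by simp
    also have "\<dots> = esym k (insert v A \<union> B) x"
      using Suc v AB by (simp add: esym_insert)
    finally show ?thesis by simp
  qed
qed

text \<open>
  Double counting explains the factor: each \<open>k\<close>-subset of \<open>A\<close> extends to some \<open>(k+1)\<close>-subset by an
  element of weight at least \<open>m\<close>, and a \<open>(k+1)\<close>-subset arises in this way at most \<open>k+1\<close> times. The
  induction on \<open>A\<close> replaces the explicit count.
\<close>

lemma esym_Suc_ge_mult_lower_bound:
  assumes "finite A" "k < card A" "0 \<le> m" "\<And>i. i \<in> A \<Longrightarrow> m \<le> x i"
  shows "m * esym k A x \<le> real (Suc k) * esym (Suc k) A x"
  using assms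
proof (induction A arbitrary: k rule: finite_induct)
  case empty
  then show ?case by simp
next
  case (insert v A)
  have mx: "m \<le> x v" and nn: "\<And>j. 0 \<le> esym j A x"
    using insert by (auto intro!: esym_nonneg intro: order_trans)
  have top: "m * esym k A x \<le> real (Suc k) * esym (Suc k) A x + x v * esym k A x"
  proof (cases "k < card A")
    case True
    then have "m * esym k A x \<le> real (Suc k) * esym (Suc k) A x"
      using insert by simp
    moreover have "0 \<le> x v * esym k A x"
      using mx nn insert.prems(2) by simp
    ultimately show ?thesis by linarith
  next
    case False
    moreover have "0 \<le> real (Suc k) * esym (Suc k) A x"
      using nn by simp
    ultimately show ?thesis
      using mult_right_mono[OF mx nn, of k] by linarith
  qed
  show ?case
  proof (cases k)
    case 0
    then show ?thesis
      using top insert(1,2) by (simp add: esym_insert esym_0)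
  next
    case (Suc l)
    have "m * esym l A x \<le> real (Suc l) * esym (Suc l) A x"
      using insert Suc by simp
    then have "x v * (m * esym l A x) \<le> x v * (real k * esym k A x)"
      using mx insert.prems(2) Suc by (intro mult_left_mono) auto
    with top show ?thesis
      using insert(1,2) Suc by (simp add: esym_insert algebra_simps)
  qed
qed

text \<open>
  A form of Newton's inequalities for the numbers \<open>s\<^sub>k = k! e\<^sub>k\<close>. The rescaling makes the binomial factors
  of Newton's inequalities disappear, and adding a variable \<open>t\<close> acts by
  \<open>s\<^sub>k \<mapsto> s\<^sub>k + k t s\<^bsub>k-1\<^esub>\<close>. Comparing the coefficients of \<open>1\<close>, \<open>t\<close> and \<open>t\<^sup>2\<close> proves the induction step.
  The statement covers all pairs \<open>j \<le> l\<close>, because deducing it from the case \<open>j = l\<close> would mean dividing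
  by some \<open>s\<^sub>k\<close> that may vanish.
\<close>

lemma fact_esym_log_concave:
  fixes x :: "'a \<Rightarrow> real"
  assumes "finite A" "\<And>i. i \<in> A \<Longrightarrow> 0 \<le> x i" "j \<le> l"
  defines "s \<equiv> \<lambda>k A. fact k * esym k A x"
  shows "s j A * s (Suc l) A \<le> s (Suc j) A * s l A"
  using assms(1-3)
proof (induction A arbitrary: j l rule: finite_induct)
  case empty
  have "s (Suc l) {} = 0" for l
    by (simp add: s_def esym_eq_0)
  then show ?case
    by (cases l) auto
next
  case (insert v A)
  have nn: "0 \<le> s k A" for k
    using insert.prems by (auto simp: s_def intro!: mult_nonneg_nonneg esym_nonneg)
  have xv: "0 \<le> x v"
    using insert.prems by simp
  have IH: "s j A * s (Suc l) A \<le> s (Suc j) A * s l A" if "j \<le> l" for j l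
    using insert.IH insert.prems that by simp
  have rec: "s (Suc k) (insert v A) = s (Suc k) A + real (Suc k) * x v * s k A" for k
    using insert(1,2) by (simp add: s_def esym_insert algebra_simps)
  have zero: "s 0 B = 1" if "finite B" for B
    using that by (simp add: s_def esym_0)
  show ?case
  proof (cases j)
    case 0
    have "s (Suc l) A + real (Suc l) * x v * s l A \<le> (s 1 A + x v) * s l (insert v A)"
    proof (cases l)
      case 0
      then show ?thesis
        using zero insert(1) by simp
    next
      case (Suc k)
      have "s (Suc l) A \<le> s 1 A * s l A"
        using IH[of 0 l] zero insert(1) by simp
      moreover have "x v * (real l * s l A) \<le> x v * (real l * (s 1 A * s k A))"
        using IH[of 0 k] zero insert(1) Suc xv by (intro mult_left_mono) auto
      moreover have "0 \<le> x v * (x v * (real l * s k A))"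
        using xv nn by simp
      ultimately show ?thesis
        using Suc by (simp add: \<open>\<And>k. s (Suc k) (insert v A) = _\<close> algebra_simps)
    qed
    then show ?thesis
      using 0 rec[of l] rec[of 0] zero insert(1) by simp
  next
    case (Suc i)
    then obtain k where l: "l = Suc k"
      using insert.prems by (cases l) auto
    have ik: "i \<le> k"
      using insert.prems Suc l by simp
    have c0: "s j A * s (Suc l) A \<le> s (Suc j) A * s l A"
      using IH insert.prems by blast
    \<comment> \<open>the coefficients of \<open>1\<close>, \<open>x v\<close> and \<open>(x v)\<^sup>2\<close> are compared in \<open>c0\<close>, \<open>c1\<close> and \<open>c2\<close>\<close>
    have c1: "real (Suc l) * (s j A * s l A) + real j * (s i A * s (Suc l) A)
        \<le> real l * (s (Suc j) A * s k A) + real (Suc j) * (s j A * s l A)"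
    proof (cases "j = l")
      case True
      then show ?thesis using Suc l by (simp add: mult.commute)
    next
      case False
      then have jl: "j \<le> k"
        using insert.prems l by simp
      have 1: "s i A * s (Suc l) A \<le> s j A * s l A"
        using IH[of i l] ik l Suc by simp
      have 2: "s j A * s l A \<le> s (Suc j) A * s k A"
        using IH[OF jl] l by simp
      have "real j * (s i A * s (Suc l) A) \<le> real j * (s j A * s l A)"
        using 1 by (intro mult_left_mono) auto
      moreover have "real l * (s j A * s l A) \<le> real l * (s (Suc j) A * s k A)"
        using 2 by (intro mult_left_mono) auto
      ultimately show ?thesis
        by (simp add: algebra_simps)
    qed
    have c2: "real j * real (Suc l) * (s i A * s l A) \<le> real (Suc j) * real l * (s j A * s k A)"
    proof (rule mult_mono)
      show "real j * real (Suc l) \<le> real (Suc j) * real l"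
        using ik Suc l by (simp add: algebra_simps)
      show "s i A * s l A \<le> s j A * s k A"
        using IH[OF ik] Suc l by simp
    qed (use nn in auto)
    have "s j (insert v A) * s (Suc l) (insert v A)
        = s j A * s (Suc l) A
          + x v * (real (Suc l) * (s j A * s l A) + real j * (s i A * s (Suc l) A))
          + x v * (x v * (real j * real (Suc l) * (s i A * s l A)))"
      unfolding rec[of l] unfolding \<open>j = Suc i\<close> rec[of i] by algebra
    also have "\<dots> \<le> s (Suc j) A * s l A
          + x v * (real l * (s (Suc j) A * s k A) + real (Suc j) * (s j A * s l A))
          + x v * (x v * (real (Suc j) * real l * (s j A * s k A)))"
      using xv by (intro add_mono mult_left_mono c0 c1 c2)
    also have "\<dots> = s (Suc j) (insert v A) * s l (insert v A)"
      unfolding rec[of j] unfolding \<open>l = Suc k\<close> rec[of k] by algebra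
    finally show ?thesis .
  qed
qed

text \<open>
  Maclaurin's inequality in the same normalization: by log-concavity and \<open>s\<^sub>0 = 1\<close>, the roots
  \<open>s\<^sub>k\<^bsup>1/k\<^esup>\<close> decrease in \<open>k\<close>. It is stated in powers so that no roots occur.
\<close>

lemma fact_esym_power_le:
  fixes x :: "'a \<Rightarrow> real"
  assumes A: "finite A" "\<And>i. i \<in> A \<Longrightarrow> 0 \<le> x i" and ja: "j \<le> a"
  defines "s \<equiv> \<lambda>k. fact k * esym k A x"
  shows "s a ^ j \<le> s j ^ a"
proof -
  have nn: "0 \<le> s k" for k
    using A by (auto simp: s_def intro!: mult_nonneg_nonneg esym_nonneg)
  have s0: "s 0 = 1"
    using A(1) by (simp add: s_def esym_0)
  have lc: "s j * s (Suc l) \<le> s (Suc j) * s l" if "j \<le> l" for j l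
    using fact_esym_log_concave[OF A that] by (simp add: s_def)
  \<comment> \<open>log-concavity at \<open>k\<close>, raised to the power \<open>k + 1\<close>, lets the induction hypothesis cancel\<close>
  have step: "s (Suc k) ^ k \<le> s k ^ Suc k" for k
  proof (induction k)
    case 0
    then show ?case using s0 by simp
  next
    case (Suc k)
    show ?case
    proof (cases "s (Suc k) = 0")
      case True
      then have "s (Suc (Suc k)) \<le> 0"
        using lc[of 0 "Suc k"] s0 by simp
      then have "s (Suc (Suc k)) = 0"
        using nn[of "Suc (Suc k)"] by linarith
      then show ?thesis using True by simp
    next
      case False
      then have pos: "0 < s (Suc k) ^ k"
        using nn[of "Suc k"] by simp
      have "s (Suc k) ^ k * s (Suc (Suc k)) ^ Suc k \<le> s k ^ Suc k * s (Suc (Suc k)) ^ Suc k"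
        using Suc.IH nn by (intro mult_right_mono) auto
      also have "\<dots> = (s k * s (Suc (Suc k))) ^ Suc k"
        by (simp add: power_mult_distrib)
      also have "\<dots> \<le> (s (Suc k) * s (Suc k)) ^ Suc k"
        using lc[of k "Suc k"] nn by (intro power_mono) auto
      also have "\<dots> = s (Suc k) ^ k * s (Suc k) ^ Suc (Suc k)"
        by (simp add: power_mult_distrib)
      finally show ?thesis
        using pos by (rule mult_left_le_imp_le)
    qed
  qed
  show ?thesis
    using ja
  proof (induction a rule: dec_induct)
    case base
    then show ?case by simp
  next
    case (step a)
    show ?case
    proof (cases "a = 0")
      case True
      then show ?thesis using step s0 by simp
    next
      case False
      have "(s (Suc a) ^ j) ^ a = (s (Suc a) ^ a) ^ j"
        by (simp add: power_mult[symmetric] mult.commute)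
      also have "\<dots> \<le> (s a ^ Suc a) ^ j"
        using \<open>\<And>k. s (Suc k) ^ k \<le> s k ^ Suc k\<close> nn by (intro power_mono) auto
      also have "\<dots> = (s a ^ j) ^ Suc a"
        by (simp only: power_mult[symmetric] mult.commute)
      also have "\<dots> \<le> (s j ^ a) ^ Suc a"
        using step nn by (intro power_mono) auto
      also have "\<dots> = (s j ^ Suc a) ^ a"
        by (simp only: power_mult[symmetric] mult.commute)
      finally show ?thesis
        using False nn by (subst (asm) power_mono_iff) auto
    qed
  qed
qed

text \<open>
  By the previous lemma \<open>s\<^sub>j(A) s\<^bsub>a-j\<^esub>(B)\<close> is at least a weighted geometric mean of \<open>s\<^sub>a(A)\<close> and
  \<open>s\<^sub>a(B)\<close>, hence at least the smaller of the two. The binomial coefficient comes from the factorials.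
\<close>

lemma esym_mult_ge_binomial:
  assumes A: "finite A" "\<And>i. i \<in> A \<Longrightarrow> 0 \<le> x i" and B: "finite B" "\<And>i. i \<in> B \<Longrightarrow> 0 \<le> x i"
    and ja: "j \<le> a" "0 < a" and le: "esym a A x \<le> esym a B x"
  shows "real (a choose j) * esym a A x \<le> esym j A x * esym (a - j) B x"
proof -
  define s where "s \<equiv> \<lambda>k. fact k * esym k A x"
  define t where "t \<equiv> \<lambda>k. fact k * esym k B x"
  have nn: "0 \<le> s k" "0 \<le> t k" for k
    using A B by (auto simp: s_def t_def intro!: mult_nonneg_nonneg esym_nonneg)
  have "s a ^ a = s a ^ j * s a ^ (a - j)"
    using ja by (simp add: power_add[symmetric])
  also have "\<dots> \<le> s a ^ j * t a ^ (a - j)"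
    using nn le by (intro mult_left_mono power_mono) (auto simp: s_def t_def)
  also have "\<dots> \<le> s j ^ a * t (a - j) ^ a"
  proof (rule mult_mono)
    show "s a ^ j \<le> s j ^ a"
      unfolding s_def using A ja(1) by (rule fact_esym_power_le)
    show "t a ^ (a - j) \<le> t (a - j) ^ a"
      unfolding t_def using B diff_le_self by (rule fact_esym_power_le)
  qed (use nn in auto)
  also have "\<dots> = (s j * t (a - j)) ^ a"
    by (simp add: power_mult_distrib)
  finally have "s a \<le> s j * t (a - j)"
    using ja nn by (subst (asm) power_mono_iff) auto
  then show ?thesis
    using ja by (simp add: s_def t_def binomial_fact field_simps)
qed

text \<open>
  This quantifies the gain of merging two parts: of the terms \<open>e\<^sub>j(A) e\<^bsub>a-j\<^esub>(B)\<close> of \<open>e\<^sub>a(A \<union> B)\<close>, the one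
  with \<open>j = 0\<close> is \<open>e\<^sub>a(B)\<close>, and the others contribute \<open>e\<^sub>a(A)\<close> with multiplicities that add up to
  \<open>2\<^sup>a - 1\<close>.
\<close>

lemma esym_Un_ge:
  assumes A: "finite A" "\<And>i. i \<in> A \<Longrightarrow> 0 \<le> x i" and B: "finite B" "\<And>i. i \<in> B \<Longrightarrow> 0 \<le> x i"
    and disj: "A \<inter> B = {}" and a: "0 < a" and le: "esym a A x \<le> esym a B x"
  shows "esym a B x + (2 ^ a - 1) * esym a A x \<le> esym a (A \<union> B) x"
proof -
  have "(\<Sum>j\<le>a. real (a choose j)) = 2 ^ a"
    using choose_row_sum[of a] by (metis of_nat_numeral of_nat_power of_nat_sum)
  moreover have split: "{..a} = insert 0 {1..a}"
    by auto
  ultimately have "(\<Sum>j=1..a. real (a choose j)) = 2 ^ a - 1"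
    by simp
  then have "(2 ^ a - 1) * esym a A x = (\<Sum>j=1..a. real (a choose j) * esym a A x)"
    by (metis sum_distrib_right)
  also have "\<dots> \<le> (\<Sum>j=1..a. esym j A x * esym (a - j) B x)"
    using A B a le by (intro sum_mono esym_mult_ge_binomial) auto
  finally show ?thesis
    using A B disj by (simp add: esym_Un split esym_0)
qed

section \<open>Weighted sums over induced copies\<close>

text \<open>
  The set \<open>S\<close> induces, in the graph with arc set \<open>R\<close>, a copy of the complete \<open>r\<close>-partite graph with
  parts of size \<open>a\<close>. Only the arcs between vertices of \<open>S\<close> matter, so graphs on different vertex sets
  can be compared without changing \<open>R\<close>.
\<close>

definition is_copy :: "nat \<Rightarrow> nat \<Rightarrow> 'a rel \<Rightarrow> 'a set \<Rightarrow> bool" where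
  "is_copy r a R S \<longleftrightarrow> (\<exists>f. bij_betw f S ({..<r} \<times> {..<a})
     \<and> (\<forall>u\<in>S. \<forall>v\<in>S. (u, v) \<in> R \<longleftrightarrow> fst (f u) \<noteq> fst (f v)))"

definition copy_sum :: "nat \<Rightarrow> nat \<Rightarrow> 'a rel \<Rightarrow> 'a set \<Rightarrow> ('a \<Rightarrow> real) \<Rightarrow> real" where
  "copy_sum r a R V x = (\<Sum>S | S \<subseteq> V \<and> is_copy r a R S. \<Prod>i\<in>S. x i)"

lemma is_copy_inv_image:
  assumes "inj_on g S"
  shows "is_copy r a (inv_image R g) S \<longleftrightarrow> is_copy r a R (g ` S)"
proof
  assume "is_copy r a (inv_image R g) S"
  then obtain f where f: "bij_betw f S ({..<r} \<times> {..<a})"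
    "\<forall>u\<in>S. \<forall>v\<in>S. (g u, g v) \<in> R \<longleftrightarrow> fst (f u) \<noteq> fst (f v)"
    by (auto simp: is_copy_def)
  have "bij_betw (f \<circ> inv_into S g) (g ` S) ({..<r} \<times> {..<a})"
    using bij_betw_inv_into[OF inj_on_imp_bij_betw[OF assms]] f(1) by (rule bij_betw_trans)
  then show "is_copy r a R (g ` S)"
    unfolding is_copy_def using f(2) assms
    by (intro exI[of _ "f \<circ> inv_into S g"]) auto
next
  assume "is_copy r a R (g ` S)"
  then obtain f where f: "bij_betw f (g ` S) ({..<r} \<times> {..<a})"
    "\<forall>u\<in>g ` S. \<forall>v\<in>g ` S. (u, v) \<in> R \<longleftrightarrow> fst (f u) \<noteq> fst (f v)"
    by (auto simp: is_copy_def)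
  have "bij_betw (f \<circ> g) S ({..<r} \<times> {..<a})"
    using assms f(1) by (intro bij_betw_trans[of g S "g ` S"]) (auto simp: bij_betw_def)
  then show "is_copy r a (inv_image R g) S"
    unfolding is_copy_def using f(2)
    by (intro exI[of _ "f \<circ> g"]) auto
qed

lemma is_copy_cong:
  assumes "\<And>u v. u \<in> S \<Longrightarrow> v \<in> S \<Longrightarrow> (u, v) \<in> R \<longleftrightarrow> (u, v) \<in> R'"
  shows "is_copy r a R S \<longleftrightarrow> is_copy r a R' S"
  using assms by (simp add: is_copy_def)

lemma copy_sum_cong:
  assumes "\<And>u v. u \<in> V \<Longrightarrow> v \<in> V \<Longrightarrow> (u, v) \<in> R \<longleftrightarrow> (u, v) \<in> R'"
    and "\<And>v. v \<in> V \<Longrightarrow> x v = y v"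
  shows "copy_sum r a R V x = copy_sum r a R' V y"
proof -
  have "is_copy r a R S \<longleftrightarrow> is_copy r a R' S" if "S \<subseteq> V" for S
    using that assms(1) by (intro is_copy_cong) auto
  then show ?thesis
    unfolding copy_sum_def using assms(2) by (intro sum.cong prod.cong) auto
qed

lemma copy_sum_image:
  assumes inj: "inj_on g V"
  shows "copy_sum r a R (g ` V) x = copy_sum r a (inv_image R g) V (x \<circ> g)"
  unfolding copy_sum_def
proof (rule sum.reindex_cong[where l = "image g"])
  have sub: "inj_on g S" if "S \<subseteq> V" for S
    using inj that by (rule inj_on_subset)
  show "inj_on (image g) {S. S \<subseteq> V \<and> is_copy r a (inv_image R g) S}"
    by (auto simp: inj_on_def inj_on_image_eq_iff[OF inj])
  show "{S. S \<subseteq> g ` V \<and> is_copy r a R S}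
      = image g ` {S. S \<subseteq> V \<and> is_copy r a (inv_image R g) S}"
    using is_copy_inv_image[OF sub] by (auto simp: subset_image_iff image_iff)
  fix S assume "S \<in> {S. S \<subseteq> V \<and> is_copy r a (inv_image R g) S}"
  then show "prod x (g ` S) = prod (x \<circ> g) S"
    using sub by (simp add: prod.reindex)
qed

section \<open>Symmetrization\<close>

definition graphs_with_vertices :: "'a set \<Rightarrow> 'a rel set" where
  "graphs_with_vertices V = {R. R \<subseteq> V \<times> V \<and> sym R \<and> irrefl R}"

text \<open>
  Adjacency of \<open>u\<close> is read off from \<open>v\<close>, so that \<open>u\<close> becomes a nonadjacent twin of \<open>v\<close> if \<open>R\<close> has no
  loops.
\<close>

abbreviation clone :: "'a \<Rightarrow> 'a \<Rightarrow> 'a rel \<Rightarrow> 'a rel" where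
  "clone u v R \<equiv> inv_image R (id(u := v))"

lemma clone_in_graphs:
  assumes "R \<in> graphs_with_vertices V" "u \<in> V"
  shows "clone u v R \<in> graphs_with_vertices V"
proof -
  have "p \<in> V" if "(id(u := v)) p \<in> V" for p
    using that assms(2) by (cases "p = u") auto
  then show ?thesis
    using assms(1) unfolding graphs_with_vertices_def
    by (auto simp: sym_def irrefl_def in_inv_image simp del: fun_upd_apply)
qed

text \<open>
  For \<open>W = V - {u, v}\<close> this is the coefficient of \<open>x v\<close> in the part of the polynomial that comes from
  the copies containing \<open>v\<close> but not \<open>u\<close>.
\<close>

definition link_sum :: "nat \<Rightarrow> nat \<Rightarrow> 'a rel \<Rightarrow> 'a set \<Rightarrow> ('a \<Rightarrow> real) \<Rightarrow> 'a \<Rightarrow> real" where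
  "link_sum r a R W x v = (\<Sum>T\<in>Pow W. if is_copy r a R (insert v T) then \<Prod>i\<in>T. x i else 0)"

text \<open>
  As a polynomial in \<open>x u\<close> and \<open>x v\<close>, the sum is \<open>C + x u * L u + x v * L v + x u * x v * D\<close>. Cloning
  keeps \<open>C\<close> and \<open>L v\<close>, replaces \<open>L u\<close> by \<open>L v\<close>, and does not decrease \<open>D\<close>, because \<open>u\<close> and \<open>v\<close> already
  are twins inside every copy that contains both.
\<close>

lemma copy_sum_clone_ge:
  assumes fin: "finite V" and uv: "u \<in> V" "v \<in> V" "u \<noteq> v" "(u, v) \<notin> R" "(v, u) \<notin> R" "(u, u) \<notin> R" "(v, v) \<notin> R"
    and x: "\<And>w. w \<in> V \<Longrightarrow> 0 \<le> x w"
  defines "W \<equiv> V - {u, v}"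
  shows "copy_sum r a R V x + x u * (link_sum r a R W x v - link_sum r a R W x u)
    \<le> copy_sum r a (clone u v R) V x"
proof -
  define w where "w R T = (if is_copy r a R T then \<Prod>i\<in>T. x i else 0)" for R T
  define D where "D R T = (if is_copy r a R (insert u (insert v T)) then \<Prod>i\<in>T. x i else 0)" for R T
  define L where "L R p T = (if is_copy r a R (insert p T) then \<Prod>i\<in>T. x i else 0)" for R p T
  have W: "finite W" "u \<notin> W" "v \<notin> W" "V = insert u (insert v W)"
    using fin uv by (auto simp: W_def)
  have fT: "finite T" "u \<notin> T" "v \<notin> T" "T \<subseteq> V" if "T \<in> Pow W" for T
    using that W by (auto dest: finite_subset)
  have expand: "copy_sum r a R V x
      = (\<Sum>T\<in>Pow W. w R T) + x v * (\<Sum>T\<in>Pow W. L R v T) + x u * (\<Sum>T\<in>Pow W. L R u T)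
        + x u * x v * (\<Sum>T\<in>Pow W. D R T)" for R
  proof -
    have "copy_sum r a R V x = (\<Sum>S\<in>Pow V. w R S)"
      using fin by (simp add: copy_sum_def w_def Pow_def sum.inter_filter[symmetric])
    also have "\<dots> = (\<Sum>T\<in>Pow W. w R T) + (\<Sum>T\<in>Pow W. w R (insert v T))
        + ((\<Sum>T\<in>Pow W. w R (insert u T)) + (\<Sum>T\<in>Pow W. w R (insert u (insert v T))))"
      using W uv by (simp add: sum_subsets_insert)
    also have "(\<Sum>T\<in>Pow W. w R (insert v T)) = x v * (\<Sum>T\<in>Pow W. L R v T)"
      unfolding sum_distrib_left by (rule sum.cong) (use fT in \<open>auto simp: w_def L_def\<close>)
    also have "(\<Sum>T\<in>Pow W. w R (insert u T)) = x u * (\<Sum>T\<in>Pow W. L R u T)"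
      unfolding sum_distrib_left by (rule sum.cong) (use fT in \<open>auto simp: w_def L_def\<close>)
    also have "(\<Sum>T\<in>Pow W. w R (insert u (insert v T))) = x u * x v * (\<Sum>T\<in>Pow W. D R T)"
      unfolding sum_distrib_left by (rule sum.cong) (use fT uv in \<open>auto simp: w_def D_def\<close>)
    finally show ?thesis by (simp only: add.assoc)
  qed
  let ?g = "id(u := v)" and ?R = "clone u v R"
  have away: "is_copy r a ?R S \<longleftrightarrow> is_copy r a R S" if "u \<notin> S" for S
    using that by (intro is_copy_cong) (auto simp: in_inv_image)
  have moved: "is_copy r a ?R (insert u T) \<longleftrightarrow> is_copy r a R (insert v T)" if "T \<in> Pow W" for T
  proof -
    have "inj_on ?g (insert u T)" "?g ` insert u T = insert v T"
      using fT[OF that] by (auto simp: inj_on_def image_iff)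
    then show ?thesis using is_copy_inv_image by metis
  qed
  have both: "is_copy r a ?R S" if copy: "is_copy r a R S" and S: "u \<in> S" "v \<in> S" for S
  proof -
    obtain f where f: "bij_betw f S ({..<r} \<times> {..<a})"
      "\<And>p q. p \<in> S \<Longrightarrow> q \<in> S \<Longrightarrow> (p, q) \<in> R \<longleftrightarrow> fst (f p) \<noteq> fst (f q)"
      using copy by (auto simp: is_copy_def)
    have "fst (f u) = fst (f v)"
      using f(2) S uv by blast
    then have "fst (f (?g p)) = fst (f p)" for p
      by simp
    moreover have "?g p \<in> S" if "p \<in> S" for p
      using that S by simp
    ultimately show ?thesis
      unfolding is_copy_def using f
      by (intro exI[of _ f]) (simp add: in_inv_image del: fun_upd_apply)
  qed
  have "(\<Sum>T\<in>Pow W. w ?R T) = (\<Sum>T\<in>Pow W. w R T)"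
    by (rule sum.cong) (use fT away in \<open>auto simp: w_def\<close>)
  moreover have "(\<Sum>T\<in>Pow W. L ?R v T) = (\<Sum>T\<in>Pow W. L R v T)"
    by (rule sum.cong) (use fT away uv in \<open>auto simp: L_def\<close>)
  moreover have "(\<Sum>T\<in>Pow W. L ?R u T) = (\<Sum>T\<in>Pow W. L R v T)"
    by (rule sum.cong) (use moved in \<open>auto simp: L_def\<close>)
  moreover have "(\<Sum>T\<in>Pow W. D R T) \<le> (\<Sum>T\<in>Pow W. D ?R T)"
  proof (rule sum_mono)
    fix T assume T: "T \<in> Pow W"
    have "0 \<le> (\<Prod>i\<in>T. x i)"
      using fT[OF T] x by (intro prod_nonneg) auto
    then show "D R T \<le> D ?R T"
      using both[of "insert u (insert v T)"] by (auto simp: D_def)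
  qed
  then have "x u * x v * (\<Sum>T\<in>Pow W. D R T) \<le> x u * x v * (\<Sum>T\<in>Pow W. D ?R T)"
    using x uv by (intro mult_left_mono) auto
  moreover have "link_sum r a R W x p = (\<Sum>T\<in>Pow W. L R p T)" for p
    by (simp add: link_sum_def L_def)
  ultimately show ?thesis
    unfolding expand by (simp add: algebra_simps)
qed

definition twins :: "'a set \<Rightarrow> 'a rel \<Rightarrow> 'a rel" where
  "twins V R = {(p, q) \<in> V \<times> V. R `` {p} = R `` {q}}"

text \<open>
  Cloning removes \<open>u\<close> from its own twin class and adds it to that of \<open>v\<close>. Vertices other than \<open>u\<close> that
  were twins remain twins, so moving \<open>u\<close> into a class that is at least as large creates more twin
  pairs than it destroys.
\<close>

lemma card_twins_clone_gt:
  assumes fin: "finite V" and R: "R \<in> graphs_with_vertices V"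
    and uv: "u \<in> V" "v \<in> V" "(u, v) \<notin> R" "(u, v) \<notin> twins V R"
    and le: "card (twins V R `` {u}) \<le> card (twins V R `` {v})"
  shows "card (twins V R) < card (twins V (clone u v R))"
proof -
  let ?R = "clone u v R"
  \<comment> \<open>twin pairs without \<open>u\<close> survive; those with \<open>u\<close> number \<open>2 * card A + 1\<close> before and at least
      \<open>2 * card B + 1\<close> after\<close>
  define N where "N = twins V R \<inter> (V - {u}) \<times> (V - {u})"
  define A where "A = twins V R `` {u} - {u}"
  define B where "B = twins V R `` {v}"
  have fin_twins: "finite (twins V R')" for R'
  proof (rule finite_subset)
    show "twins V R' \<subseteq> V \<times> V"
      unfolding twins_def by blast
  qed (use fin in simp)
  have finN: "finite N" and finA: "finite A" and finB: "finite B"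
    unfolding N_def A_def B_def
    by (intro finite_Int disjI1 finite_Diff finite_Image fin_twins)+
  have "u \<in> twins V R `` {u}"
    using uv unfolding twins_def by blast
  moreover have "finite (twins V R `` {u})"
    using fin_twins[of R] by (rule finite_Image)
  ultimately have cA: "card A < card B"
    using le card_Diff1_less[of "twins V R `` {u}" u] unfolding A_def B_def by linarith
  have uB: "u \<notin> B"
    using uv unfolding B_def twins_def by blast
  have nb: "?R `` {p} = {q. ((id(u := v)) p, (id(u := v)) q) \<in> R}" for p
    by (auto simp: in_inv_image)
  have symR: "(p, q) \<in> R \<longleftrightarrow> (q, p) \<in> R" for p q
    using R by (auto simp: graphs_with_vertices_def sym_def)
  have nbu: "?R `` {u} = ?R `` {v}"
    using uv(4) by (simp add: nb)
  have keep: "?R `` {p} = ?R `` {q}" if "R `` {p} = R `` {q}" "p \<noteq> u" "q \<noteq> u" for p q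
    using that by (auto simp: nb)
  have "twins V R \<subseteq> N \<union> ({u} \<times> A \<union> A \<times> {u} \<union> {(u, u)})"
    unfolding N_def A_def twins_def by blast
  then have "card (twins V R) \<le> card (N \<union> ({u} \<times> A \<union> A \<times> {u} \<union> {(u, u)}))"
    using finN finA by (intro card_mono) auto
  also have "\<dots> \<le> card N + (card ({u} \<times> A) + card (A \<times> {u}) + card {(u, u)})"
    by (intro order_trans[OF card_Un_le] add_mono order_refl)
  also have "\<dots> = card N + (2 * card A + 1)"
    by (simp add: card_cartesian_product)
  also have "\<dots> < card N + (2 * card B + 1)"
    using cA by simp
  also have "\<dots> = card N + card ({u} \<times> B \<union> B \<times> {u} \<union> {(u, u)})"
    using finB uB
    by (subst card_Un_disjoint, (auto simp: card_cartesian_product)[3])+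
      (auto simp: card_cartesian_product)
  also have "\<dots> = card (N \<union> ({u} \<times> B \<union> B \<times> {u} \<union> {(u, u)}))"
    using finN finB by (subst card_Un_disjoint) (auto simp: N_def)
  also have "\<dots> \<le> card (twins V ?R)"
  proof (rule card_mono)
    show "finite (twins V ?R)"
      by (rule fin_twins)
    have Bu: "q \<in> V \<and> ?R `` {q} = ?R `` {u}" if "q \<in> B" for q
    proof -
      have q: "q \<in> V" "R `` {v} = R `` {q}"
        using that unfolding B_def twins_def by blast+
      have "q \<noteq> u" "v \<noteq> u"
        using that uB q(2) uv unfolding twins_def by blast+
      then show ?thesis
        using keep[OF q(2)] nbu q(1) by metis
    qed
    have "N \<subseteq> twins V ?R"
      unfolding N_def twins_def using keep by blast
    moreover have "{u} \<times> B \<union> B \<times> {u} \<union> {(u, u)} \<subseteq> twins V ?R"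
      unfolding twins_def using Bu uv(1) by blast
    ultimately show "N \<union> ({u} \<times> B \<union> B \<times> {u} \<union> {(u, u)}) \<subseteq> twins V ?R"
      by (rule Un_least)
  qed
  finally show ?thesis .
qed

definition multipartite_rel :: "'a set \<Rightarrow> ('a \<Rightarrow> 'c) \<Rightarrow> 'a rel" where
  "multipartite_rel V c = {(u, v) \<in> V \<times> V. c u \<noteq> c v}"

text \<open>
  Among the graphs that maximize the sum, one with the most twin pairs is complete multipartite.
  If two nonadjacent vertices were not twins, maximality would make cloning in either direction
  neutral, and cloning towards the larger twin class would increase the number of twin pairs. The
  weights are positive so that neutrality forces equality of the link sums. The colour of a vertex
  is its neighbourhood.
\<close>

lemma exists_multipartite_copy_sum_ge:
  assumes fin: "finite V" and x: "\<And>w. w \<in> V \<Longrightarrow> 0 < x w" and R\<^sub>0: "R\<^sub>0 \<in> graphs_with_vertices V"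
  shows "\<exists>c :: 'a \<Rightarrow> 'a set. copy_sum r a R\<^sub>0 V x \<le> copy_sum r a (multipartite_rel V c) V x"
proof -
  define P where "P R = copy_sum r a R V x" for R
  let ?G = "graphs_with_vertices V"
  have finG: "finite ?G"
    by (rule finite_subset[of _ "Pow (V \<times> V)"]) (use fin in \<open>auto simp: graphs_with_vertices_def\<close>)
  define M where "M = {R \<in> ?G. P R = Max (P ` ?G)}"
  have finM: "finite M"
    using finG by (simp add: M_def)
  have "Max (P ` ?G) \<in> P ` ?G"
    using finG R\<^sub>0 by (intro Max_in) auto
  then have neM: "M \<noteq> {}"
    by (auto simp: M_def)
  have Pmax: "P R' \<le> P R" if "R \<in> M" "R' \<in> ?G" for R R'
    using that finG by (simp add: M_def)
  let ?t = "\<lambda>R. card (twins V R)"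
  have "Max (?t ` M) \<in> ?t ` M"
    using finM neM by (intro Max_in) auto
  then obtain R where R: "R \<in> M" and "?t R = Max (?t ` M)"
    by auto
  then have Rtwins: "?t R' \<le> ?t R" if "R' \<in> M" for R'
    using finM that by simp
  have RG: "R \<in> ?G"
    using R by (simp add: M_def)
  then have symR: "(p, q) \<in> R \<Longrightarrow> (q, p) \<in> R" and irreflR: "(p, p) \<notin> R"
    and subR: "R \<subseteq> V \<times> V" for p q
    by (auto simp: graphs_with_vertices_def sym_def irrefl_def)
  define L where "L u v p = link_sum r a R (V - {u, v}) x p" for u v p
  have gain: "P R + x u * (L u v v - L u v u) \<le> P (clone u v R)"
    and clone_max: "P (clone u v R) \<le> P R"
    if "u \<in> V" "v \<in> V" "u \<noteq> v" "(u, v) \<notin> R" for u v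
  proof -
    show "P R + x u * (L u v v - L u v u) \<le> P (clone u v R)"
      unfolding P_def L_def using that symR irreflR x
      by (intro copy_sum_clone_ge fin) (auto intro: less_imp_le)
    show "P (clone u v R) \<le> P R"
      using clone_in_graphs[OF RG] that Pmax[OF R] by blast
  qed
  have L_le: "L u v v \<le> L u v u" if "u \<in> V" "v \<in> V" "u \<noteq> v" "(u, v) \<notin> R" for u v
  proof -
    have "x u * (L u v v - L u v u) \<le> 0"
      using gain[OF that] clone_max[OF that] by linarith
    then show ?thesis
      using x[OF that(1)] by (simp add: mult_le_0_iff)
  qed
  have "(u, v) \<in> twins V R" if "u \<in> V" "v \<in> V" "(u, v) \<notin> R"
      and le: "card (twins V R `` {u}) \<le> card (twins V R `` {v})" for u v
  proof (rule ccontr)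
    assume nt: "(u, v) \<notin> twins V R"
    then have neq: "u \<noteq> v"
      using that by (auto simp: twins_def)
    have "(v, u) \<notin> R"
      using that symR by blast
    then have "L u v u = L u v v"
      using L_le[of u v] L_le[of v u] that neq by (simp add: L_def insert_commute)
    then have "P (clone u v R) = P R"
      using gain[of u v] clone_max[of u v] that neq by simp
    then have "clone u v R \<in> M"
      using R clone_in_graphs[OF RG that(1)] by (simp add: M_def)
    then show False
      using Rtwins card_twins_clone_gt[OF fin RG that(1,2,3) nt le] by fastforce
  qed
  then have tw: "R `` {u} = R `` {v}" if "u \<in> V" "v \<in> V" "(u, v) \<notin> R" for u v
    using that symR linear[of "card (twins V R `` {u})" "card (twins V R `` {v})"]
    unfolding twins_def by blast
  have "R = multipartite_rel V (\<lambda>u. R `` {u})"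
  proof (intro set_eqI iffI; clarify)
    fix u v assume uv: "(u, v) \<in> R"
    then have "R `` {u} \<noteq> R `` {v}"
      using irreflR[of v] by blast
    then show "(u, v) \<in> multipartite_rel V (\<lambda>u. R `` {u})"
      using uv subR unfolding multipartite_rel_def by blast
  next
    fix u v assume "(u, v) \<in> multipartite_rel V (\<lambda>u. R `` {u})"
    then show "(u, v) \<in> R"
      using tw[of u v] unfolding multipartite_rel_def by blast
  qed
  then show ?thesis
    using Pmax[OF R R\<^sub>0] unfolding P_def by metis
qed

section \<open>Colourings and complete multipartite graphs\<close>

lemma exists_bij_onto_classes:
  assumes fin: "finite V" and I: "c ` V \<subseteq> I"
  shows "\<exists>g. bij_betw g V (SIGMA i:I. {..<card {v \<in> V. c v = i}}) \<and> (\<forall>v. fst (g v) = c v)"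
proof -
  have "\<exists>k. bij_betw k {v \<in> V. c v = i} {..<card {v \<in> V. c v = i}}" for i
    using ex_bij_betw_finite_nat[of "{v \<in> V. c v = i}"] fin by (simp add: atLeast0LessThan)
  then obtain k where k: "\<And>i. bij_betw (k i) {v \<in> V. c v = i} {..<card {v \<in> V. c v = i}}"
    by metis
  have inj: "u = v" if "u \<in> V" "v \<in> V" "c u = c v" "k (c u) u = k (c v) v" for u v
    using bij_betw_imp_inj_on[OF k[of "c v"]] that by (auto simp: inj_on_def)
  have im: "k i ` {v \<in> V. c v = i} = {..<card {v \<in> V. c v = i}}" for i
    using k by (rule bij_betw_imp_surj_on)
  have "bij_betw (\<lambda>v. (c v, k (c v) v)) V (SIGMA i:I. {..<card {v \<in> V. c v = i}})"
    unfolding bij_betw_def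
  proof
    show "inj_on (\<lambda>v. (c v, k (c v) v)) V"
      using inj by (auto intro!: inj_onI)
    show "(\<lambda>v. (c v, k (c v) v)) ` V = (SIGMA i:I. {..<card {v \<in> V. c v = i}})"
    proof (intro set_eqI iffI)
      fix p assume "p \<in> (\<lambda>v. (c v, k (c v) v)) ` V"
      then obtain v where "v \<in> V" "p = (c v, k (c v) v)"
        by blast
      moreover from this have "k (c v) v \<in> k (c v) ` {u \<in> V. c u = c v}"
        by blast
      ultimately show "p \<in> (SIGMA i:I. {..<card {v \<in> V. c v = i}})"
        using I unfolding im by blast
    next
      fix p assume "p \<in> (SIGMA i:I. {..<card {v \<in> V. c v = i}})"
      then obtain i q where "p = (i, q)" "q \<in> k i ` {v \<in> V. c v = i}"
        unfolding im by blast
      then show "p \<in> (\<lambda>v. (c v, k (c v) v)) ` V"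
        by blast
    qed
  qed
  then show ?thesis
    by (intro exI[of _ "\<lambda>v. (c v, k (c v) v)"]) simp
qed

lemma card_image_eq_if_same_kernel:
  assumes "\<And>u v. u \<in> S \<Longrightarrow> v \<in> S \<Longrightarrow> c u = c v \<longleftrightarrow> d u = d v"
  shows "card (c ` S) = card (d ` S)"
proof -
  have d: "d (inv_into S c (c v)) = d v" if "v \<in> S" for v
    using assms[of "inv_into S c (c v)" v] that by (simp add: inv_into_into f_inv_into_f)
  have "d ` S = (d \<circ> inv_into S c) ` c ` S"
    using d by (force simp: image_image)
  moreover have "inj_on (d \<circ> inv_into S c) (c ` S)"
    using d assms by (auto simp: inj_on_def)
  ultimately show ?thesis
    by (metis card_image)
qed

lemma is_copy_multipartite:
  assumes S: "finite S" "S \<subseteq> V" and a: "0 < a"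
  shows "is_copy r a (multipartite_rel V c) S
    \<longleftrightarrow> card (c ` S) = r \<and> (\<forall>i\<in>c ` S. card {v \<in> S. c v = i} = a)"
proof
  assume "is_copy r a (multipartite_rel V c) S"
  then obtain f where f: "bij_betw f S ({..<r} \<times> {..<a})"
    and cf: "\<And>u v. u \<in> S \<Longrightarrow> v \<in> S \<Longrightarrow> c u = c v \<longleftrightarrow> fst (f u) = fst (f v)"
    using S(2) unfolding is_copy_def multipartite_rel_def by blast
  have im: "f ` S = {..<r} \<times> {..<a}"
    using f by (rule bij_betw_imp_surj_on)
  have "card (c ` S) = card ((\<lambda>v. fst (f v)) ` S)"
    using cf by (rule card_image_eq_if_same_kernel)
  also have "(\<lambda>v. fst (f v)) ` S = fst ` f ` S"
    by (simp add: image_image)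
  also have "\<dots> = {..<r}"
    using a by (auto simp: im fst_image_times)
  finally have "card (c ` S) = r" by simp
  moreover have "card {v \<in> S. c v = c u} = a" if u: "u \<in> S" for u
  proof -
    have "f ` {v \<in> S. c v = c u} = {p \<in> f ` S. fst p = fst (f u)}"
      using cf u by blast
    also have "\<dots> = {fst (f u)} \<times> {..<a}"
      using bij_betw_apply[OF f u] by (auto simp: im)
    finally have "card (f ` {v \<in> S. c v = c u}) = a"
      by (simp add: card_cartesian_product)
    moreover have "inj_on f {v \<in> S. c v = c u}"
      using bij_betw_imp_inj_on[OF f] by (rule inj_on_subset) blast
    ultimately show ?thesis
      by (simp add: card_image)
  qed
  ultimately show "card (c ` S) = r \<and> (\<forall>i\<in>c ` S. card {v \<in> S. c v = i} = a)"
    by blast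
next
  assume c: "card (c ` S) = r \<and> (\<forall>i\<in>c ` S. card {v \<in> S. c v = i} = a)"
  obtain g where g: "bij_betw g S (SIGMA i:c ` S. {..<card {v \<in> S. c v = i}})"
    and gc: "\<And>v. fst (g v) = c v"
    using exists_bij_onto_classes[OF S(1), of c "c ` S"] by blast
  have "(SIGMA i:c ` S. {..<card {v \<in> S. c v = i}}) = c ` S \<times> {..<a}"
    using c by (intro Sigma_cong) auto
  with g have g: "bij_betw g S (c ` S \<times> {..<a})" by simp
  obtain h where h: "bij_betw h (c ` S) {..<r}"
    using ex_bij_betw_finite_nat[of "c ` S"] S(1) c by (auto simp: atLeast0LessThan)
  have "bij_betw (map_prod h id \<circ> g) S ({..<r} \<times> {..<a})"
    using g bij_betw_map_prod[OF h bij_betw_id] by (rule bij_betw_trans)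
  moreover have "(u, v) \<in> multipartite_rel V c
      \<longleftrightarrow> fst ((map_prod h id \<circ> g) u) \<noteq> fst ((map_prod h id \<circ> g) v)" if "u \<in> S" "v \<in> S" for u v
    using that S(2) gc inj_on_eq_iff[OF bij_betw_imp_inj_on[OF h], of "c u" "c v"]
    by (auto simp: multipartite_rel_def)
  ultimately show "is_copy r a (multipartite_rel V c) S"
    unfolding is_copy_def by blast
qed

text \<open>
  A copy is obtained by choosing \<open>r\<close> colours and, independently, \<open>a\<close> vertices in each of the chosen
  classes, which turns the sum over copies into a composition of elementary symmetric polynomials.
\<close>

lemma copy_sum_multipartite:
  assumes fin: "finite V" and a: "0 < a"
  shows "copy_sum r a (multipartite_rel V c) V x
    = esym r (c ` V) (\<lambda>i. esym a {v \<in> V. c v = i} x)"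
proof -
  let ?V = "\<lambda>i. {v \<in> V. c v = i}"
  let ?B = "\<lambda>i. {T. T \<subseteq> ?V i \<and> card T = a}"
  let ?Q = "{Q. Q \<subseteq> c ` V \<and> card Q = r}"
  have finQ: "finite Q" if "Q \<in> ?Q" for Q
  proof (rule finite_subset)
    show "Q \<subseteq> c ` V" using that by blast
  qed (use fin in simp)
  have finB: "finite (?B i)" for i
    using fin by simp
  have finT: "finite T" if "T \<in> ?B i" for T i
  proof (rule finite_subset)
    show "T \<subseteq> V" using that by blast
  qed (rule fin)
  have "esym r (c ` V) (\<lambda>i. esym a (?V i) x) = (\<Sum>Q\<in>?Q. \<Sum>g\<in>PiE Q ?B. \<Prod>i\<in>Q. \<Prod>v\<in>g i. x v)"
    unfolding esym_def
  proof (rule sum.cong[OF refl])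
    fix Q assume "Q \<in> ?Q"
    then show "(\<Prod>i\<in>Q. \<Sum>T\<in>?B i. \<Prod>v\<in>T. x v) = (\<Sum>g\<in>PiE Q ?B. \<Prod>i\<in>Q. \<Prod>v\<in>g i. x v)"
      using finB by (intro prod_sum_PiE finQ)
  qed
  also have "\<dots> = (\<Sum>(Q, g)\<in>(SIGMA Q:?Q. PiE Q ?B). \<Prod>i\<in>Q. \<Prod>v\<in>g i. x v)"
  proof (rule sum.Sigma)
    show "finite ?Q" using fin by simp
    show "\<forall>Q\<in>?Q. finite (PiE Q ?B)" using finQ finB by (intro ballI finite_PiE)
  qed
  also have "\<dots> = (\<Sum>S | S \<subseteq> V \<and> is_copy r a (multipartite_rel V c) S. \<Prod>v\<in>S. x v)"
  proof (rule sum.reindex_bij_witness[where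
      i = "\<lambda>S. (c ` S, \<lambda>i\<in>c ` S. {v \<in> S. c v = i})" and j = "\<lambda>(Q, g). \<Union>i\<in>Q. g i"])
    fix p assume "p \<in> (SIGMA Q:?Q. PiE Q ?B)"
    then obtain Q g where p: "p = (Q, g)" and Q: "Q \<subseteq> c ` V" "card Q = r" and g: "g \<in> PiE Q ?B"
      by blast
    have gi: "g i \<subseteq> ?V i" "card (g i) = a" if "i \<in> Q" for i
      using PiE_mem[OF g that] by auto
    have fg: "finite (g i)" if "i \<in> Q" for i
      using PiE_mem[OF g that] by (rule finT)
    let ?S = "\<Union>i\<in>Q. g i"
    have cls: "{v \<in> ?S. c v = i} = g i" if "i \<in> Q" for i
      using gi that by blast
    have "g i \<noteq> {}" if "i \<in> Q" for i
      using gi[OF that] a by auto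
    then have cS: "c ` ?S = Q"
      using gi by blast
    have SV: "?S \<subseteq> V"
      using gi by blast
    have "is_copy r a (multipartite_rel V c) ?S"
      unfolding is_copy_multipartite[OF finite_subset[OF SV fin] SV a] cS
      using cls gi(2) Q(2) by simp
    then show "(case p of (Q, g) \<Rightarrow> \<Union>i\<in>Q. g i) \<in> {S. S \<subseteq> V \<and> is_copy r a (multipartite_rel V c) S}"
      using SV p by simp
    have "(\<lambda>i\<in>Q. {v \<in> ?S. c v = i}) = g"
      using cls g by (intro ext) (auto simp: PiE_def extensional_def)
    then show "(c ` (case p of (Q, g) \<Rightarrow> \<Union>i\<in>Q. g i),
        \<lambda>i\<in>c ` (case p of (Q, g) \<Rightarrow> \<Union>i\<in>Q. g i). {v \<in> (case p of (Q, g) \<Rightarrow> \<Union>i\<in>Q. g i). c v = i}) = p"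
      unfolding p prod.case cS by simp
    have "(\<Prod>v\<in>?S. x v) = (\<Prod>i\<in>Q. \<Prod>v\<in>g i. x v)"
    proof (rule prod.UNION_disjoint)
      show "finite Q" using Q by (intro finQ) blast
      show "\<forall>i\<in>Q. finite (g i)" using fg by blast
      show "\<forall>i\<in>Q. \<forall>j\<in>Q. i \<noteq> j \<longrightarrow> g i \<inter> g j = {}" using gi by blast
    qed
    then show "(\<Prod>v\<in>(case p of (Q, g) \<Rightarrow> \<Union>i\<in>Q. g i). x v)
        = (case p of (Q, g) \<Rightarrow> \<Prod>i\<in>Q. \<Prod>v\<in>g i. x v)"
      by (simp add: p)
  next
    fix S assume "S \<in> {S. S \<subseteq> V \<and> is_copy r a (multipartite_rel V c) S}"
    then have SV: "S \<subseteq> V" and copy: "is_copy r a (multipartite_rel V c) S"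
      by auto
    have "card (c ` S) = r" "\<forall>i\<in>c ` S. card {v \<in> S. c v = i} = a"
      using copy unfolding is_copy_multipartite[OF finite_subset[OF SV fin] SV a] by blast+
    moreover have "c ` S \<subseteq> c ` V" "\<And>i. {v \<in> S. c v = i} \<subseteq> ?V i"
      using SV by blast+
    ultimately show "(c ` S, \<lambda>i\<in>c ` S. {v \<in> S. c v = i}) \<in> (SIGMA Q:?Q. PiE Q ?B)"
      by (intro SigmaI CollectI conjI PiE_I) (simp_all only: restrict_apply mem_Collect_eq if_True if_False simp_thms)
    show "(case (c ` S, \<lambda>i\<in>c ` S. {v \<in> S. c v = i}) of (Q, g) \<Rightarrow> \<Union>i\<in>Q. g i) = S"
      by auto
  qed
  finally show ?thesis
    by (simp add: copy_sum_def)
qed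

section \<open>Merging colour classes\<close>

text \<open>
  The two classes \<open>i\<close> and \<open>j\<close> with the smallest values \<open>y i \<le> y j\<close> are merged. The values outside them
  are at least \<open>y j\<close>, so the copies that used both classes amount to at most \<open>r - 1\<close> times \<open>y i\<close> per
  choice of \<open>r - 1\<close> other classes, while the value of the merged class exceeds \<open>y i + y j\<close> by at least
  \<open>(2\<^sup>a - 2) * y i\<close>.
\<close>

lemma exists_merged_coloring:
  fixes c :: "'a \<Rightarrow> 'c"
  assumes fin: "finite V" and x: "\<And>v. v \<in> V \<Longrightarrow> 0 \<le> x v"
    and a: "0 < a" and r: "2 \<le> r" "r \<le> 2 ^ a - 1" and many: "r < card (c ` V)"
  shows "\<exists>c' :: 'a \<Rightarrow> 'c. card (c' ` V) < card (c ` V) \<and>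
    copy_sum r a (multipartite_rel V c) V x \<le> copy_sum r a (multipartite_rel V c') V x"
proof -
  define y where "y i = esym a {v \<in> V. c v = i} x" for i
  define I where "I = c ` V"
  have finI: "finite I" and cardI: "r < card I"
    using fin many by (auto simp: I_def)
  have y: "0 \<le> y i" for i
    unfolding y_def using x by (intro esym_nonneg) auto
  have minimal: "\<exists>i\<in>A. \<forall>k\<in>A. y i \<le> y k" if "finite A" "A \<noteq> {}" for A
    using ex_is_arg_min_if_finite[OF that, of y] by (auto simp: is_arg_min_linorder)
  obtain i where i: "i \<in> I" "\<And>k. k \<in> I \<Longrightarrow> y i \<le> y k"
    using minimal[of I] finI cardI by fastforce
  have cardI': "card (I - {i}) = card I - 1"
    using i(1) finI by simp
  then have "I - {i} \<noteq> {}"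
    using r cardI by fastforce
  then obtain j where j: "j \<in> I - {i}" "\<And>k. k \<in> I - {i} \<Longrightarrow> y j \<le> y k"
    using minimal[of "I - {i}"] finI by blast
  define J where "J = I - {i, j}"
  have J: "finite J" "i \<notin> J" "j \<notin> J" "i \<noteq> j" "I = insert i (insert j J)"
    using i j finI by (auto simp: J_def)
  have cardJ: "card I = Suc (Suc (card J))"
    using J by simp
  define c' where "c' v = (if c v = i then j else c v)" for v
  have c'V: "c' ` V = insert j J"
    using J unfolding c'_def I_def[symmetric] J_def using j by (auto simp: I_def image_iff)
  have Vj: "{v \<in> V. c' v = j} = {v \<in> V. c v = i} \<union> {v \<in> V. c v = j}"
    by (auto simp: c'_def)
  have Vk: "{v \<in> V. c' v = k} = {v \<in> V. c v = k}" if "k \<in> J" for k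
    using that J by (auto simp: c'_def)
  define z where "z = esym a {v \<in> V. c' v = j} x"
  obtain s where s: "r = Suc (Suc s)"
    using r(1) by (metis One_nat_def Suc_1 Suc_le_D le_SucE Suc_leD)
  define E where "E k = esym k J y" for k
  have E: "0 \<le> E k" for k
    unfolding E_def using y by (intro esym_nonneg) auto
  have before: "copy_sum r a (multipartite_rel V c) V x
      = E r + y j * E (Suc s) + y i * (E (Suc s) + y j * E s)"
  proof -
    have "copy_sum r a (multipartite_rel V c) V x = esym r I y"
      using fin a by (simp add: copy_sum_multipartite I_def y_def[abs_def])
    then show ?thesis
      using J by (simp add: s esym_insert E_def)
  qed
  have after: "copy_sum r a (multipartite_rel V c') V x = E r + z * E (Suc s)"
  proof -
    have "copy_sum r a (multipartite_rel V c') V x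
        = esym r (insert j J) (\<lambda>k. esym a {v \<in> V. c' v = k} x)"
      using fin a by (simp add: copy_sum_multipartite c'V)
    also have "\<dots> = esym r (insert j J) (y(j := z))"
      by (rule esym_cong) (auto simp: y_def z_def Vk)
    also have "\<dots> = esym r J (y(j := z)) + z * esym (Suc s) J (y(j := z))"
      using J by (simp add: s esym_insert)
    also have "\<dots> = E r + z * E (Suc s)"
    proof -
      have "esym k J (y(j := z)) = E k" for k
        unfolding E_def using J(3) by (intro esym_cong) auto
      then show ?thesis by simp
    qed
    finally show ?thesis .
  qed
  have z: "y j + (2 ^ a - 1) * y i \<le> z"
    unfolding z_def Vj y_def using fin x a j(1) i(2)[of j] J(4)
    by (intro esym_Un_ge) (auto simp: y_def)
  have "y j * E s \<le> real (Suc s) * E (Suc s)"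
    unfolding E_def using J y j(2) cardI cardJ s
    by (intro esym_Suc_ge_mult_lower_bound) auto
  also have "\<dots> \<le> (2 ^ a - 2) * E (Suc s)"
  proof (intro mult_right_mono E)
    have "Suc (Suc (Suc s)) \<le> 2 ^ a"
      using r s by linarith
    then have "real (Suc (Suc (Suc s))) \<le> 2 ^ a"
      by (metis of_nat_le_iff of_nat_numeral of_nat_power)
    then show "real (Suc s) \<le> 2 ^ a - 2"
      by simp
  qed
  finally have "y i * (y j * E s) \<le> y i * ((2 ^ a - 2) * E (Suc s))"
    using y by (rule mult_left_mono)
  moreover have "(y j + (2 ^ a - 1) * y i) * E (Suc s) \<le> z * E (Suc s)"
    using z E by (rule mult_right_mono)
  ultimately have "copy_sum r a (multipartite_rel V c) V x \<le> copy_sum r a (multipartite_rel V c') V x"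
    unfolding before after by (simp add: algebra_simps)
  moreover have "card (c' ` V) < card (c ` V)"
    unfolding c'V using cardJ J by (simp add: I_def)
  ultimately show ?thesis by blast
qed

lemma exists_coloring_few_classes:
  fixes c :: "'a \<Rightarrow> 'c"
  assumes fin: "finite V" and x: "\<And>v. v \<in> V \<Longrightarrow> 0 \<le> x v"
    and a: "0 < a" and r: "2 \<le> r" "r \<le> 2 ^ a - 1"
  shows "\<exists>c' :: 'a \<Rightarrow> 'c. card (c' ` V) \<le> r \<and>
    copy_sum r a (multipartite_rel V c) V x \<le> copy_sum r a (multipartite_rel V c') V x"
proof (induction "card (c ` V)" arbitrary: c rule: less_induct)
  case less
  show ?case
  proof (cases "card (c ` V) \<le> r")
    case False
    then obtain c' :: "'a \<Rightarrow> 'c" where c': "card (c' ` V) < card (c ` V)"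
      and le: "copy_sum r a (multipartite_rel V c) V x \<le> copy_sum r a (multipartite_rel V c') V x"
      using exists_merged_coloring[where c = c and x = x, OF fin x a r] by auto
    then show ?thesis
      using less.hyps[OF c'] order_trans[OF le] by blast
  qed blast
qed

lemma copy_sum_support:
  assumes fin: "finite V" and sub: "V' \<subseteq> V" and zero: "\<And>v. v \<in> V - V' \<Longrightarrow> x v = 0"
  shows "copy_sum r a R V x = copy_sum r a R V' x"
  unfolding copy_sum_def
proof (rule sum.mono_neutral_right)
  show "\<forall>S\<in>{S. S \<subseteq> V \<and> is_copy r a R S} - {S. S \<subseteq> V' \<and> is_copy r a R S}. prod x S = 0"
    using zero fin by (auto intro!: prod_zero intro: finite_subset)
qed (use fin sub in auto)

text \<open>
  Symmetrization is carried out on the support of \<open>x\<close>, where the weights are positive. A vertex of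
  weight zero belongs to no copy that counts, and can receive any colour.
\<close>

lemma exists_r_coloring_copy_sum_ge:
  assumes fin: "finite V" and x: "\<And>v. v \<in> V \<Longrightarrow> 0 \<le> x v"
    and a: "0 < a" and r: "2 \<le> r" "r \<le> 2 ^ a - 1" and R: "R \<in> graphs_with_vertices V"
  shows "\<exists>c :: 'a \<Rightarrow> nat. (\<forall>v. c v < r) \<and>
    copy_sum r a R V x \<le> copy_sum r a (multipartite_rel V c) V x"
proof -
  define V' where "V' = {v \<in> V. 0 < x v}"
  have V': "finite V'" "V' \<subseteq> V" "\<And>v. v \<in> V' \<Longrightarrow> 0 < x v"
    using fin by (auto simp: V'_def)
  have zero: "x v = 0" if "v \<in> V - V'" for v
    using that x[of v] by (auto simp: V'_def)
  have "R \<inter> V' \<times> V' \<in> graphs_with_vertices V'"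
    using R by (auto simp: graphs_with_vertices_def sym_def irrefl_def)
  then obtain c\<^sub>0 :: "'a \<Rightarrow> 'a set" where
    c\<^sub>0: "copy_sum r a (R \<inter> V' \<times> V') V' x \<le> copy_sum r a (multipartite_rel V' c\<^sub>0) V' x"
    using exists_multipartite_copy_sum_ge[where x = x, OF V'(1,3)] by blast
  obtain c\<^sub>1 :: "'a \<Rightarrow> 'a set" where c\<^sub>1: "card (c\<^sub>1 ` V') \<le> r"
    "copy_sum r a (multipartite_rel V' c\<^sub>0) V' x \<le> copy_sum r a (multipartite_rel V' c\<^sub>1) V' x"
    using exists_coloring_few_classes[where c = c\<^sub>0 and x = x, OF V'(1) less_imp_le[OF V'(3)] a r] by blast
  obtain h where h: "bij_betw h (c\<^sub>1 ` V') {..<card (c\<^sub>1 ` V')}"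
    using ex_bij_betw_finite_nat[of "c\<^sub>1 ` V'"] V'(1) by (auto simp: atLeast0LessThan)
  define c where "c v = (if v \<in> V' then h (c\<^sub>1 v) else 0)" for v
  have "c v < r" for v
    using bij_betw_apply[OF h, of "c\<^sub>1 v"] c\<^sub>1(1) r(1) by (auto simp: c_def)
  moreover have "copy_sum r a R V x \<le> copy_sum r a (multipartite_rel V c) V x"
  proof -
    have "copy_sum r a R V x = copy_sum r a R V' x"
      using fin V'(2) zero by (rule copy_sum_support)
    also have "\<dots> = copy_sum r a (R \<inter> V' \<times> V') V' x"
      by (rule copy_sum_cong) auto
    also have "\<dots> \<le> copy_sum r a (multipartite_rel V' c\<^sub>1) V' x"
      using c\<^sub>0 c\<^sub>1(2) by (rule order_trans)
    also have "\<dots> = copy_sum r a (multipartite_rel V c) V' x"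
      using V'(2) inj_on_eq_iff[OF bij_betw_imp_inj_on[OF h]]
      by (intro copy_sum_cong) (auto simp: multipartite_rel_def c_def)
    also have "\<dots> = copy_sum r a (multipartite_rel V c) V x"
      using fin V'(2) zero by (rule copy_sum_support[symmetric])
    finally show ?thesis .
  qed
  ultimately show ?thesis by blast
qed

section \<open>Comparison of the maxima\<close>

text \<open>
  An isomorphism of digraphs acts on vertices and arcs separately. Here the action on arcs is
  determined by the action on vertices, which leaves a bijection that respects adjacency.
\<close>

lemma ind_copies_complete_multipartite:
  "ind_copies (complete_multipartite (replicate r a)) G
    = {S. S \<subseteq> pverts G \<and> is_copy r a (parcs G) S}"
proof -
  let ?F = "complete_multipartite (replicate r a)"
  have vF: "pverts ?F = {..<r} \<times> {..<a}"
    by (auto simp: pverts_complete_multipartite)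
  have aF: "parcs ?F = {(u, v). u \<in> pverts ?F \<and> v \<in> pverts ?F \<and> fst u \<noteq> fst v}"
    by (simp add: complete_multipartite_def Let_def)
  have "digraph_iso (induce_subgraph (with_proj G) S) (with_proj ?F) \<longleftrightarrow> is_copy r a (parcs G) S"
    if "S \<subseteq> pverts G" for S
  proof
    let ?H = "induce_subgraph (with_proj G) S"
    let ?A = "{e \<in> parcs G. fst e \<in> S \<and> snd e \<in> S}"
    have H: "verts ?H = S" "arcs ?H = ?A" "tail ?H = fst" "head ?H = snd"
      by (auto simp: induce_subgraph_def)
    {
      assume "digraph_iso ?H (with_proj ?F)"
      then obtain h where h: "pre_digraph.digraph_isomorphism ?H h" "with_proj ?F = app_iso h ?H"
        unfolding digraph_iso_def by blast
      define f where "f = iso_verts h"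
      have inj: "inj_on f S"
        and arc: "\<And>e. e \<in> ?A \<Longrightarrow> f (fst e) = iso_tail h (iso_arcs h e) \<and> f (snd e) = iso_head h (iso_arcs h e)"
        using h(1) unfolding pre_digraph.digraph_isomorphism_def H f_def by auto
      have im: "f ` S = pverts ?F" and arcs: "iso_arcs h ` ?A = parcs ?F"
        and proj: "iso_tail h = fst" "iso_head h = snd"
        using arg_cong[OF h(2), of verts] arg_cong[OF h(2), of arcs]
          arg_cong[OF h(2), of tail] arg_cong[OF h(2), of head]
        unfolding app_iso_simps H f_def by simp_all
      have "iso_arcs h e = map_prod f f e" if "e \<in> ?A" for e
        using arc[OF that] proj by (simp add: prod_eq_iff)
      then have arcs': "map_prod f f ` ?A = parcs ?F"
        using arcs by (metis (no_types, lifting) image_cong)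
      have "(u, v) \<in> parcs G \<longleftrightarrow> fst (f u) \<noteq> fst (f v)" if uv: "u \<in> S" "v \<in> S" for u v
      proof -
        have "(u, v) \<in> parcs G \<longleftrightarrow> (f u, f v) \<in> map_prod f f ` ?A"
        proof
          assume "(u, v) \<in> parcs G"
          then show "(f u, f v) \<in> map_prod f f ` ?A"
            using uv by (intro image_eqI[of _ _ "(u, v)"]) auto
        next
          assume "(f u, f v) \<in> map_prod f f ` ?A"
          then obtain p q where pq: "(p, q) \<in> parcs G" "p \<in> S" "q \<in> S" "f p = f u" "f q = f v"
            by auto
          then have "p = u" "q = v"
            using uv inj by (auto dest: inj_onD)
          then show "(u, v) \<in> parcs G"
            using pq(1) by simp
        qed
        also have "\<dots> \<longleftrightarrow> fst (f u) \<noteq> fst (f v)"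
          using uv im unfolding arcs' aF by blast
        finally show ?thesis .
      qed
      moreover have "bij_betw f S ({..<r} \<times> {..<a})"
        using inj im vF by (simp add: bij_betw_def)
      ultimately show "is_copy r a (parcs G) S"
        unfolding is_copy_def by blast
    next
      assume "is_copy r a (parcs G) S"
      then obtain f where f: "bij_betw f S (pverts ?F)"
        and adj: "\<And>u v. u \<in> S \<Longrightarrow> v \<in> S \<Longrightarrow> (u, v) \<in> parcs G \<longleftrightarrow> fst (f u) \<noteq> fst (f v)"
        unfolding is_copy_def vF by blast
      have inj: "inj_on f S" and im: "f ` S = pverts ?F"
        using f by (auto simp: bij_betw_def)
      define h where "h = \<lparr> iso_verts = f, iso_arcs = map_prod f f, iso_head = snd, iso_tail = fst \<rparr>"
      have "inj_on (map_prod f f) ?A"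
        using map_prod_inj_on[OF inj inj] by (rule inj_on_subset) auto
      moreover have "wf_digraph ?H"
        by (auto simp: wf_digraph_def)
      ultimately have "pre_digraph.digraph_isomorphism ?H h"
        unfolding pre_digraph.digraph_isomorphism_def H using inj by (simp add: h_def)
      moreover have "map_prod f f ` ?A = parcs ?F"
      proof (intro set_eqI iffI)
        fix p assume "p \<in> map_prod f f ` ?A"
        then show "p \<in> parcs ?F"
          unfolding aF im[symmetric] using adj by auto
      next
        fix p assume "p \<in> parcs ?F"
        then obtain u v where "p = (f u, f v)" "u \<in> S" "v \<in> S" "fst (f u) \<noteq> fst (f v)"
          unfolding aF im[symmetric] by auto
        then show "p \<in> map_prod f f ` ?A"
          using adj by (intro image_eqI[of _ _ "(u, v)"]) auto
      qed
      then have "with_proj ?F = app_iso h ?H"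
        using im by (intro pre_digraph.equality) (simp_all add: H h_def)
      ultimately show "digraph_iso ?H (with_proj ?F)"
        unfolding digraph_iso_def by blast
    }
  qed
  then show ?thesis
    unfolding ind_copies_def by blast
qed

lemma ind_poly_eq_copy_sum:
  "ind_poly (complete_multipartite (replicate r a)) G x
    = fact (r * a) * copy_sum r a (parcs G) (pverts G) x"
  by (simp add: ind_poly_def copy_sum_def ind_copies_complete_multipartite
      card_complete_multipartite sum_list_replicate)

lemma copy_sum_le_abs: "copy_sum r a R V x \<le> copy_sum r a R V (\<lambda>v. \<bar>x v\<bar>)"
  unfolding copy_sum_def by (intro sum_mono) (simp add: abs_prod[symmetric])

text \<open>
  A bijection from \<open>V\<close> onto the vertices of the complete multipartite graph with the same class sizes
  carries \<open>x\<close> to a vector with the same norm and the same value of the polynomial.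
\<close>

lemma exists_composition_copy_sum_le_lambda:
  assumes fin: "finite V" and n: "card V = n" "1 \<le> n" and c: "\<And>v. c v < r"
    and \<alpha>: "0 < \<alpha>" and x: "x \<in> unit_vectors \<alpha> V"
  shows "\<exists>ns\<in>compositions r n. fact (r * a) * copy_sum r a (multipartite_rel V c) V x
    \<le> lambda_ind \<alpha> (complete_multipartite (replicate r a)) (complete_multipartite ns)"
proof -
  define ns where "ns = map (\<lambda>i. card {v \<in> V. c v = i}) [0..<r]"
  let ?K = "complete_multipartite ns"
  have vK: "pverts ?K = (SIGMA i:{..<r}. {..<card {v \<in> V. c v = i}})"
    by (auto simp: pverts_complete_multipartite ns_def)
  have aK: "parcs ?K = {(u, v). u \<in> pverts ?K \<and> v \<in> pverts ?K \<and> fst u \<noteq> fst v}"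
    by (simp add: complete_multipartite_def Let_def)
  obtain g where g: "bij_betw g V (pverts ?K)" and gc: "\<And>v. fst (g v) = c v"
    using exists_bij_onto_classes[OF fin, of c "{..<r}"] c unfolding vK by blast
  have inj: "inj_on g V" and im: "g ` V = pverts ?K"
    using g by (auto simp: bij_betw_def)
  have "ns \<in> compositions r n"
    using bij_betw_same_card[OF g] n
    by (simp add: compositions_def card_complete_multipartite) (simp add: ns_def)
  moreover have "fact (r * a) * copy_sum r a (multipartite_rel V c) V x
    \<le> lambda_ind \<alpha> (complete_multipartite (replicate r a)) ?K"
  proof -
    define y where "y = x \<circ> inv_into V g"
    have yg: "y (g v) = x v" if "v \<in> V" for v
      using that inj by (simp add: y_def)
    have "copy_sum r a (multipartite_rel V c) V x = copy_sum r a (inv_image (parcs ?K) g) V (y \<circ> g)"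
    proof (rule copy_sum_cong)
      fix u v assume "u \<in> V" "v \<in> V"
      then show "(u, v) \<in> multipartite_rel V c \<longleftrightarrow> (u, v) \<in> inv_image (parcs ?K) g"
        unfolding aK im[symmetric] by (auto simp: multipartite_rel_def gc)
    qed (simp add: yg)
    also have "\<dots> = copy_sum r a (parcs ?K) (pverts ?K) y"
      using copy_sum_image[OF inj] im by metis
    finally have "fact (r * a) * copy_sum r a (multipartite_rel V c) V x
        = ind_poly (complete_multipartite (replicate r a)) ?K y"
      by (simp add: ind_poly_eq_copy_sum)
    also have "\<dots> \<le> lambda_ind \<alpha> (complete_multipartite (replicate r a)) ?K"
    proof (rule lambda_ind_attained(2)[OF _ _ \<alpha>])
      show "finite (pverts ?K)" "pverts ?K \<noteq> {}"
        using fin n unfolding im[symmetric] by auto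
      have "(\<Sum>p\<in>pverts ?K. \<bar>y p\<bar> powr \<alpha>) = (\<Sum>v\<in>V. \<bar>x v\<bar> powr \<alpha>)"
        unfolding im[symmetric] using inj yg by (simp add: sum.reindex)
      then show "y \<in> unit_vectors \<alpha> (pverts ?K)"
        using x by (simp add: unit_vectors_def)
    qed
    finally show ?thesis .
  qed
  ultimately show ?thesis by blast
qed

lemma parcs_in_graphs_with_vertices:
  assumes "pair_graph G"
  shows "parcs G \<in> graphs_with_vertices (pverts G)"
proof -
  interpret pair_graph G by (rule assms)
  have "sym (parcs G)"
    using pair_sym_arcs by (simp add: symmetric_def)
  moreover have "irrefl (parcs G)"
    by (auto intro!: irreflI dest: pair_no_loops)
  moreover have "parcs G \<subseteq> pverts G \<times> pverts G"
    using in_arcsD1 in_arcsD2 by auto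
  ultimately show ?thesis
    by (simp add: graphs_with_vertices_def)
qed

theorem theorem1p4:
  fixes a r n :: nat and \<alpha> :: real
  assumes "a \<ge> 2" and "r \<ge> 2" and "r \<le> 2 ^ a - 1"
    and "\<alpha> \<ge> 1" and "n \<ge> 1"
  shows "spec_ind \<alpha> (complete_multipartite (replicate r a)) n =
    Max ((\<lambda>ns. lambda_ind \<alpha> (complete_multipartite (replicate r a)) (complete_multipartite ns))
      ` compositions r n)"
proof (rule antisym)
  let ?F = "complete_multipartite (replicate r a)"
  let ?L = "\<lambda>ns. lambda_ind \<alpha> ?F (complete_multipartite ns)"
  have \<alpha>: "0 < \<alpha>" and a: "0 < a"
    using assms by auto
  have "lambda_ind \<alpha> ?F G \<le> Max (?L ` compositions r n)" if "G \<in> graphs_on n" for G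
  proof -
    have G: "pair_graph G" "pverts G = {..<n}"
      using that by (auto simp: graphs_on_def)
    obtain x where x: "x \<in> unit_vectors \<alpha> {..<n}" "ind_poly ?F G x = lambda_ind \<alpha> ?F G"
      using lambda_ind_attained(1)[of G \<alpha> ?F] G(2) \<alpha> assms(5) by (auto simp: lessThan_empty_iff)
    let ?x = "\<lambda>v. \<bar>x v\<bar>"
    have "parcs G \<in> graphs_with_vertices {..<n}"
      using parcs_in_graphs_with_vertices[OF G(1)] G(2) by simp
    then obtain c :: "nat \<Rightarrow> nat" where c: "\<forall>v. c v < r"
      "copy_sum r a (parcs G) {..<n} ?x \<le> copy_sum r a (multipartite_rel {..<n} c) {..<n} ?x"
      using exists_r_coloring_copy_sum_ge[where x = ?x, OF finite_lessThan abs_ge_zero a assms(2,3)] by blast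
    have "?x \<in> unit_vectors \<alpha> {..<n}"
      using x(1) by (simp add: unit_vectors_def)
    then obtain ns where ns: "ns \<in> compositions r n"
      "fact (r * a) * copy_sum r a (multipartite_rel {..<n} c) {..<n} ?x \<le> ?L ns"
      using exists_composition_copy_sum_le_lambda[of "{..<n}" n c r \<alpha> ?x a] c(1) assms(5) \<alpha> by auto
    have "lambda_ind \<alpha> ?F G = fact (r * a) * copy_sum r a (parcs G) {..<n} x"
      using x(2) G(2) by (simp add: ind_poly_eq_copy_sum)
    also have "\<dots> \<le> fact (r * a) * copy_sum r a (multipartite_rel {..<n} c) {..<n} ?x"
      using order_trans[OF copy_sum_le_abs c(2)] by (intro mult_left_mono) auto
    also have "\<dots> \<le> ?L ns"
      by (rule ns(2))
    also have "\<dots> \<le> Max (?L ` compositions r n)"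
      using ns(1) by (intro Max_ge finite_imageI finite_compositions imageI)
    finally show ?thesis .
  qed
  then show "spec_ind \<alpha> ?F n \<le> Max (?L ` compositions r n)"
    unfolding spec_ind_def
    using finite_graphs_on graphs_on_nonempty by (subst Max_le_iff) auto
  have "?L ns \<le> spec_ind \<alpha> ?F n" if "ns \<in> compositions r n" for ns
    using that assms(5) \<alpha>
    by (intro lambda_ind_le_spec_ind pair_graph_complete_multipartite)
      (auto simp: compositions_def card_complete_multipartite)
  then show "Max (?L ` compositions r n) \<le> spec_ind \<alpha> ?F n"
    using finite_compositions compositions_nonempty[of r n] assms(2) by (subst Max_le_iff) auto
qed

end
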